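(* Let $N=2$ and $p>1$. Let $R(\cdot)$ be a function defined for large $\alpha$ with $0\le R(\alpha)<1$, and suppose there is $\delta>0$ such that $\limsup_{\alpha\to\infty}\alpha^\delta R(\alpha)<\infty$. Then there exists $\alpha_*>0$ such that for all $\alpha>\alpha_*$, with the weight $V=V_{R(\alpha),\alpha}$, one has $S_\alpha<S_{\alpha,\mathrm{rad}}$ and no groundstate of $(\mathcal P)$ is radially symmetric.
   Context: Let $B=B(0,1)\subset\mathbb R^2$. For $\alpha>0$ and $R\in(0,1)$ define the radial weight $V=V_{R,\alpha}$ by $V(r)=(1-r/R)^\alpha$ for $0\le r<R$ and $V(r)=\left(1-\frac{1-r}{1-R}\right)^\alpha$ for $R\le r\le 1$; for $R=0$ set $V(|x|)=|x|^\alpha$. Problem $(\mathcal P)$: $-\Delta u=V(|x|)|u|^{p-1}u$ in $B$, $u=0$ on $\partial B$. $S_{\alpha}=\inf_{0\ne u\in H^1_0(B)}\frac{\int_B|Du|^2}{(\int_B V|u|^{p+1})^{2/(p+1)}}$ and $S_{\alpha,\mathrm{rad}}$ is the same infimum over radial $0\ne u\in H^1_{0,\mathrm{rad}}(B)$. A groundstate of $(\mathcal P)$ is $u_\alpha=S_\alpha^{1/(p-1)}u^*_\alpha$ with $u^*_\alpha$ a positive minimiser of $S_\alpha$ normalised by $\int_BV|u^*_\alpha|^{p+1}=1$. *)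

theory Defs
  imports "HOL-Analysis.Analysis"
begin

definition unit_ball :: "(real^2) set" where
  "unit_ball = ball 0 1"

definition V_weight :: "real \<Rightarrow> real \<Rightarrow> real \<Rightarrow> real" where
  "V_weight R \<alpha> r =
     (if R = 0 then r powr \<alpha>
      else if r < R then (1 - r / R) powr \<alpha>
      else (1 - (1 - r) / (1 - R)) powr \<alpha>)"

definition test_fun :: "(real^2 \<Rightarrow> real) \<Rightarrow> (real^2 \<Rightarrow> real^2) \<Rightarrow> bool" where
  "test_fun \<phi> g \<longleftrightarrow>
     continuous_on UNIV g \<and>
     (\<forall>x. (\<phi> has_derivative (\<lambda>h. g x \<bullet> h)) (at x)) \<and>
     closure {x. \<phi> x \<noteq> 0} \<subseteq> unit_ball"

text \<open>H10 u G: u belongs to H^1_0(B) (closure of compactly supported C^1 functions in the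
  H^1 norm) and G is its weak gradient.\<close>
definition H10 :: "(real^2 \<Rightarrow> real) \<Rightarrow> (real^2 \<Rightarrow> real^2) \<Rightarrow> bool" where
  "H10 u G \<longleftrightarrow>
     set_borel_measurable lebesgue unit_ball u \<and>
     set_borel_measurable lebesgue unit_ball G \<and>
     set_integrable lebesgue unit_ball (\<lambda>x. (u x)\<^sup>2) \<and>
     set_integrable lebesgue unit_ball (\<lambda>x. (norm (G x))\<^sup>2) \<and>
     (\<exists>\<phi> g. (\<forall>n::nat. test_fun (\<phi> n) (g n)) \<and>
        (\<lambda>n. LINT x:unit_ball|lebesgue. (\<phi> n x - u x)\<^sup>2) \<longlonglongrightarrow> 0 \<and>
        (\<lambda>n. LINT x:unit_ball|lebesgue. (norm (g n x - G x))\<^sup>2) \<longlonglongrightarrow> 0)"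

definition nonzero_fun :: "(real^2 \<Rightarrow> real) \<Rightarrow> bool" where
  "nonzero_fun u \<longleftrightarrow> \<not> (AE x in lebesgue. x \<in> unit_ball \<longrightarrow> u x = 0)"

definition radial :: "(real^2 \<Rightarrow> real) \<Rightarrow> bool" where
  "radial u \<longleftrightarrow> (\<exists>f::real \<Rightarrow> real. AE x in lebesgue. x \<in> unit_ball \<longrightarrow> u x = f (norm x))"

definition weighted_int :: "real \<Rightarrow> real \<Rightarrow> real \<Rightarrow> (real^2 \<Rightarrow> real) \<Rightarrow> real" where
  "weighted_int R \<alpha> p u = (LINT x:unit_ball|lebesgue. V_weight R \<alpha> (norm x) * \<bar>u x\<bar> powr (p + 1))"

definition dirichlet :: "(real^2 \<Rightarrow> real^2) \<Rightarrow> real" where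
  "dirichlet G = (LINT x:unit_ball|lebesgue. (norm (G x))\<^sup>2)"

definition rayleigh :: "real \<Rightarrow> real \<Rightarrow> real \<Rightarrow> (real^2 \<Rightarrow> real) \<Rightarrow> (real^2 \<Rightarrow> real^2) \<Rightarrow> real" where
  "rayleigh R \<alpha> p u G = dirichlet G / (weighted_int R \<alpha> p u) powr (2 / (p + 1))"

definition S_alpha :: "real \<Rightarrow> real \<Rightarrow> real \<Rightarrow> real" where
  "S_alpha R \<alpha> p = Inf {rayleigh R \<alpha> p u G | u G. H10 u G \<and> nonzero_fun u}"

definition S_alpha_rad :: "real \<Rightarrow> real \<Rightarrow> real \<Rightarrow> real" where
  "S_alpha_rad R \<alpha> p = Inf {rayleigh R \<alpha> p u G | u G. H10 u G \<and> nonzero_fun u \<and> radial u}"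

definition groundstate :: "real \<Rightarrow> real \<Rightarrow> real \<Rightarrow> (real^2 \<Rightarrow> real) \<Rightarrow> bool" where
  "groundstate R \<alpha> p w \<longleftrightarrow>
     (\<exists>u G. H10 u G \<and> (AE x in lebesgue. x \<in> unit_ball \<longrightarrow> u x > 0) \<and>
        weighted_int R \<alpha> p u = 1 \<and> rayleigh R \<alpha> p u G = S_alpha R \<alpha> p \<and>
        w = (\<lambda>x. S_alpha R \<alpha> p powr (1 / (p - 1)) * u x))"

end

theory Submission
  imports Defs
begin

text \<open>
  Write \<open>q = (p + 1) / 2\<close>. Integrating the gradient along rays and using the Cauchy--Schwarz
  inequality, a radial \<open>u\<close> in \<open>H\<^sup>1\<^sub>0\<close> satisfies \<open>u(x)\<^sup>2 \<le> ln (1 / |x|) D / (2 \<pi>)\<close> almost everywhere,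
  where \<open>D\<close> is its Dirichlet integral. Hence its Rayleigh quotient is at least \<open>2 \<pi> / J powr (1/q)\<close>,
  where \<open>J\<close> bounds the integral of \<open>V ln (1 / |x|) powr q\<close>. For \<open>|x| \<ge> R\<close> one has \<open>V \<le> |x| powr \<alpha>\<close>,
  which contributes \<open>O(\<alpha> powr (- q - 1))\<close>; the part \<open>|x| < R\<close> contributes \<open>O((R / \<alpha>) powr k)\<close> for
  every \<open>k < 2\<close>. As \<open>q > 1\<close> and \<open>R = O(\<alpha> powr - \<delta>)\<close>, both are \<open>o(1 / \<alpha>\<^sup>2)\<close>. On the other hand, a
  bump of width \<open>1 / \<alpha>\<close> at distance \<open>2 / \<alpha>\<close> from the boundary has bounded Dirichlet integral and
  weighted integral of order \<open>1 / \<alpha>\<^sup>2\<close>, so its Rayleigh quotient is smaller than that of every radial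
  function by a factor tending to infinity.
\<close>

subsection \<open>Log-polar coordinates\<close>

text \<open>The threshold 1 / \<alpha>^2 is the area of a disc of radius 1 / \<alpha>. A bump on
  such a disc costs a bounded Dirichlet energy, which is scale invariant in the plane, while a
  radial function concentrating near the boundary loses a further factor \<alpha>^(q - 1). Near the
  origin the weight decays like exp (-\<alpha> |x| / R), so a radial function can also use a disc of
  area about (R / \<alpha>)^2. For constant R this would compete with the bump; the decay of R gains
  a power of \<alpha>, enough to afford some k below 2. The obstacle is that \<open>H10\<close>
  offers only an approximating sequence: no trace, no representative that is absolutely continuous
  on rays. So the ray estimate is first integrated over a set of radii; in this first-order form it
  survives L^1 limits, and the pointwise bound is recovered afterwards. Moreover, Bochner integrals
  default to 0 and so does division by 0, so a Rayleigh quotient might vanish spuriously; the radial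
  bound therefore includes integrability and positivity of the weighted integral.\<close>

lemma nn_integral_lborel_dilation:
  fixes f :: "'a::euclidean_space \<Rightarrow> ennreal"
  assumes [measurable]: "f \<in> borel_measurable borel" and "c > 0"
  shows "(\<integral>\<^sup>+x. f (c *\<^sub>R x) \<partial>lborel) = ennreal (1 / c ^ DIM('a)) * (\<integral>\<^sup>+x. f x \<partial>lborel)"
proof -
  have "(\<integral>\<^sup>+x. f x \<partial>lborel) =
      (\<integral>\<^sup>+x. f x \<partial>density (distr lborel borel (\<lambda>x. 0 + c *\<^sub>R x)) (\<lambda>_. \<bar>c\<bar>^DIM('a)))"
    using lborel_affine[of c "0::'a"] assms(2) by simp
  also have "\<dots> = ennreal (c ^ DIM('a)) * (\<integral>\<^sup>+x. f (c *\<^sub>R x) \<partial>lborel)"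
    using assms(2) by (simp add: nn_integral_density nn_integral_distr nn_integral_cmult ennreal_power)
  finally have *: "(\<integral>\<^sup>+x. f x \<partial>lborel) = ennreal (c ^ DIM('a)) * (\<integral>\<^sup>+x. f (c *\<^sub>R x) \<partial>lborel)" .
  show ?thesis
    unfolding * using assms(2)
    by (simp add: mult.assoc[symmetric] ennreal_mult[symmetric])
qed

lemma nn_integral_lborel_shift:
  fixes f :: "real \<Rightarrow> ennreal"
  assumes [measurable]: "f \<in> borel_measurable borel"
  shows "(\<integral>\<^sup>+x. f (x + t) \<partial>lborel) = (\<integral>\<^sup>+x. f x \<partial>lborel)"
  using nn_integral_real_affine[OF assms, of 1 t] by (simp add: add.commute)

lemma nn_integral_exp_atLeast:
  fixes n b :: real
  assumes "n > 0"
  shows "(\<integral>\<^sup>+\<tau>. ennreal (exp (- n * \<tau>)) * indicator {b..} \<tau> \<partial>lborel) = ennreal (exp (- n * b) / n)"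
proof -
  have "((\<lambda>\<tau>. - exp (- n * \<tau>) / n) \<longlongrightarrow> 0) at_top"
  proof -
    have "((\<lambda>\<tau>. exp (- (n * \<tau>))) \<longlongrightarrow> 0) at_top"
      using assms
      by (intro filterlim_compose[OF exp_at_bot]
          filterlim_compose[OF filterlim_uminus_at_bot_at_top]
          filterlim_tendsto_pos_mult_at_top[OF tendsto_const] filterlim_ident)
    from tendsto_mult[OF this tendsto_const[of "- 1 / n"]] show ?thesis by simp
  qed
  then have "(\<integral>\<^sup>+\<tau>. ennreal (exp (- n * \<tau>)) * indicator {b..} \<tau> \<partial>lborel) =
      ennreal (0 - (- exp (- n * b) / n))"
    using assms
    by (intro nn_integral_FTC_atLeast) (auto intro!: derivative_eq_intros)
  then show ?thesis by simp
qed

text \<open>Log-polar coordinates. Evaluate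
  \<open>\<integral>\<integral> f (exp \<tau> * norm x) d\<tau> dx\<close> over the unit ball in both orders: by translation invariance
  in \<open>\<tau>\<close> the inner integral does not depend on \<open>x\<close>, and dilating \<open>x\<close> by \<open>exp \<tau>\<close> instead
  produces the weight \<open>norm x powr - n\<close>.\<close>
lemma nn_integral_log_polar:
  fixes f :: "real \<Rightarrow> ennreal"
  assumes [measurable]: "f \<in> borel_measurable borel"
  shows "(\<integral>\<^sup>+x. f (norm x) * ennreal (1 / norm x ^ DIM('a)) \<partial>(lborel :: 'a::euclidean_space measure))
    = ennreal (DIM('a) * unit_ball_vol (real DIM('a))) * (\<integral>\<^sup>+\<tau>. f (exp \<tau>) \<partial>lborel)"
proof -
  define n where "n = DIM('a)"
  have n: "n > 0" by (simp add: n_def)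
  define k where "k = (indicator (ball 0 1) :: 'a \<Rightarrow> ennreal)"
  have [measurable]: "k \<in> borel_measurable borel" unfolding k_def by (intro borel_measurable_indicator borel_open open_ball)
  have nz: "AE x in lborel. x \<noteq> (0::'a)" by (rule AE_lborel_singleton)
  have A: "(\<integral>\<^sup>+\<tau>. f (exp \<tau> * norm x) \<partial>lborel) = (\<integral>\<^sup>+\<tau>. f (exp \<tau>) \<partial>lborel)" if "x \<noteq> 0" for x :: 'a
    using nn_integral_lborel_shift[of "\<lambda>\<tau>. f (exp \<tau>)" "ln (norm x)"] that by (simp add: exp_add)
  have "(\<integral>\<^sup>+x. k x * (\<integral>\<^sup>+\<tau>. f (exp \<tau> * norm x) \<partial>lborel) \<partial>lborel)
      = (\<integral>\<^sup>+x. k x * (\<integral>\<^sup>+\<tau>. f (exp \<tau>) \<partial>lborel) \<partial>(lborel :: 'a measure))"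
    by (rule nn_integral_cong_AE) (use nz A in auto)
  also have "\<dots> = (\<integral>\<^sup>+x. k x \<partial>(lborel :: 'a measure)) * (\<integral>\<^sup>+\<tau>. f (exp \<tau>) \<partial>lborel)"
    by (rule nn_integral_multc) measurable
  also have "(\<integral>\<^sup>+x. k x \<partial>(lborel :: 'a measure)) = ennreal (unit_ball_vol (real DIM('a)))"
    by (simp add: k_def emeasure_ball)
  finally have L: "(\<integral>\<^sup>+x. k x * (\<integral>\<^sup>+\<tau>. f (exp \<tau> * norm x) \<partial>lborel) \<partial>lborel)
      = ennreal (unit_ball_vol (real DIM('a))) * (\<integral>\<^sup>+\<tau>. f (exp \<tau>) \<partial>lborel)" .
  have "(\<integral>\<^sup>+x. k x * (\<integral>\<^sup>+\<tau>. f (exp \<tau> * norm x) \<partial>lborel) \<partial>lborel)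
      = (\<integral>\<^sup>+x. (\<integral>\<^sup>+\<tau>. k x * f (exp \<tau> * norm x) \<partial>lborel) \<partial>lborel)"
    by (intro nn_integral_cong nn_integral_cmult[symmetric]) measurable
  also have "\<dots> = (\<integral>\<^sup>+\<tau>. (\<integral>\<^sup>+x. k x * f (exp \<tau> * norm x) \<partial>lborel) \<partial>lborel)"
    by (rule lborel_pair.Fubini') measurable
  also have "\<dots> = (\<integral>\<^sup>+\<tau>. ennreal (exp (- real n * \<tau>)) *
      (\<integral>\<^sup>+x. k (exp (- \<tau>) *\<^sub>R x) * f (norm x) \<partial>lborel) \<partial>lborel)"
  proof (rule nn_integral_cong)
    fix \<tau> :: real
    show "(\<integral>\<^sup>+x. k x * f (exp \<tau> * norm x) \<partial>lborel) = ennreal (exp (- real n * \<tau>)) *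
      (\<integral>\<^sup>+x. k (exp (- \<tau>) *\<^sub>R x) * f (norm x) \<partial>lborel)"
      using nn_integral_lborel_dilation[of "\<lambda>x. k (exp (- \<tau>) *\<^sub>R x) * f (norm x)" "exp \<tau>"]
      by (simp add: n_def exp_of_nat_mult[symmetric] exp_minus field_simps)
  qed
  also have "\<dots> = (\<integral>\<^sup>+\<tau>. (\<integral>\<^sup>+x. ennreal (exp (- real n * \<tau>)) *
      (k (exp (- \<tau>) *\<^sub>R x) * f (norm x)) \<partial>lborel) \<partial>lborel)"
    by (intro nn_integral_cong nn_integral_cmult[symmetric]) measurable
  also have "\<dots> = (\<integral>\<^sup>+x. (\<integral>\<^sup>+\<tau>. ennreal (exp (- real n * \<tau>)) *
      (k (exp (- \<tau>) *\<^sub>R x) * f (norm x)) \<partial>lborel) \<partial>lborel)"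
    by (rule lborel_pair.Fubini') measurable
  also have "\<dots> = (\<integral>\<^sup>+x. f (norm x) * ennreal (1 / norm x ^ n) * ennreal (1 / n) \<partial>(lborel::'a measure))"
  proof (rule nn_integral_cong_AE, use nz in eventually_elim)
    case (elim x)
    have k: "k (exp (- \<tau>) *\<^sub>R x) = indicator {ln (norm x)<..} \<tau>" for \<tau>
    proof -
      have "exp (-\<tau>) * norm x < 1 \<longleftrightarrow> norm x < exp \<tau>" by (simp add: exp_minus field_simps)
      also have "\<dots> \<longleftrightarrow> ln (norm x) < \<tau>" using elim by (metis exp_less_cancel_iff exp_ln zero_less_norm_iff)
      finally show ?thesis by (simp add: k_def indicator_def)
    qed
    have "(\<integral>\<^sup>+\<tau>. ennreal (exp (- real n * \<tau>)) * (k (exp (- \<tau>) *\<^sub>R x) * f (norm x)) \<partial>lborel)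
        = (\<integral>\<^sup>+\<tau>. ennreal (exp (- real n * \<tau>)) * indicator {ln (norm x)..} \<tau> * f (norm x) \<partial>lborel)"
      by (rule nn_integral_cong_AE, use AE_lborel_singleton[of "ln (norm x)"] in eventually_elim)
        (auto simp: k indicator_def)
    also have "\<dots> = ennreal (exp (- real n * ln (norm x)) / n) * f (norm x)"
      using nn_integral_exp_atLeast[of "real n" "ln (norm x)"] n
      by (subst nn_integral_multc) auto
    also have "exp (- real n * ln (norm x)) / n = (1 / norm x ^ n) * (1 / n)"
      using elim by (simp add: exp_of_nat_mult exp_minus field_simps)
    also have "ennreal ((1 / norm x ^ n) * (1 / n)) = ennreal (1 / norm x ^ n) * ennreal (1 / n)"
      by (rule ennreal_mult) auto
    finally show ?case by (simp add: mult_ac)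
  qed
  also have "\<dots> = (\<integral>\<^sup>+x. f (norm x) * ennreal (1 / norm x ^ n) \<partial>(lborel::'a measure)) * ennreal (1 / n)"
    by (rule nn_integral_multc) measurable
  finally have "(\<integral>\<^sup>+x. f (norm x) * ennreal (1 / norm x ^ n) \<partial>(lborel::'a measure)) * ennreal (1 / n) =
     ennreal (unit_ball_vol (real DIM('a))) * (\<integral>\<^sup>+\<tau>. f (exp \<tau>) \<partial>lborel)" using L by simp
  then have "(\<integral>\<^sup>+x. f (norm x) * ennreal (1 / norm x ^ n) \<partial>(lborel::'a measure)) * (ennreal (1 / n) * ennreal n) =
     ennreal n * ennreal (unit_ball_vol (real DIM('a))) * (\<integral>\<^sup>+\<tau>. f (exp \<tau>) \<partial>lborel)"
    by (metis (no_types, lifting) mult.assoc mult.commute)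
  moreover have "ennreal (1 / n) * ennreal n = 1"
    using n by (simp add: ennreal_mult[symmetric])
  moreover have "ennreal n * ennreal (unit_ball_vol (real DIM('a))) = ennreal (n * unit_ball_vol (real DIM('a)))"
    by (rule ennreal_mult[symmetric]) auto
  ultimately show ?thesis unfolding n_def by simp
qed

text \<open>With r = exp \<tau> the usual density r dr becomes exp (2 * \<tau>) d\<tau>. It arises
  by applying \<open>nn_integral_log_polar\<close> to f times the squared norm, which cancels the
  weight there; the origin is a null set.\<close>

lemma nn_integral_log_polar_plane:
  fixes f :: "real \<Rightarrow> ennreal"
  assumes [measurable]: "f \<in> borel_measurable borel"
  shows "(\<integral>\<^sup>+x. f (norm x) \<partial>(lborel :: (real^2) measure))
    = ennreal (2 * pi) * (\<integral>\<^sup>+\<tau>. f (exp \<tau>) * ennreal (exp (2 * \<tau>)) \<partial>lborel)"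
proof -
  have "(\<integral>\<^sup>+x. f (norm x) \<partial>(lborel :: (real^2) measure)) =
      (\<integral>\<^sup>+x. f (norm x) * ennreal ((norm x)\<^sup>2) * ennreal (1 / norm x ^ DIM(real^2)) \<partial>(lborel :: (real^2) measure))"
  proof (rule nn_integral_cong_AE, use AE_lborel_singleton[of "0::real^2"] in eventually_elim)
    case (elim x)
    then show ?case by (simp add: mult.assoc ennreal_mult[symmetric])
  qed
  also have "\<dots> = ennreal (2 * pi) * (\<integral>\<^sup>+\<tau>. f (exp \<tau>) * ennreal ((exp \<tau>)\<^sup>2) \<partial>lborel)"
    by (subst nn_integral_log_polar) (auto simp: unit_ball_vol_2)
  finally show ?thesis by (simp add: exp_double)
qed

text \<open>The threshold -2 is the integrability limit at the origin in the plane; it is what later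
  imposes \<open>k + \<eta> < 2\<close>.\<close>

lemma nn_integral_unit_ball_powr:
  assumes "\<beta> > -2"
  shows "(\<integral>\<^sup>+x. indicator unit_ball x * ennreal (norm x powr \<beta>) \<partial>lborel) = ennreal (2 * pi / (\<beta> + 2))"
proof -
  define f where "f r = indicator {..<1} r * ennreal (r powr \<beta>)" for r :: real
  have [measurable]: "f \<in> borel_measurable borel" unfolding f_def by measurable
  have "(\<integral>\<^sup>+x. indicator unit_ball x * ennreal (norm x powr \<beta>) \<partial>lborel) = (\<integral>\<^sup>+x. f (norm x) \<partial>(lborel :: (real^2) measure))"
    by (intro nn_integral_cong) (auto simp: f_def unit_ball_def indicator_def)
  also have "\<dots> = ennreal (2 * pi) * (\<integral>\<^sup>+\<tau>. f (exp \<tau>) * ennreal (exp (2 * \<tau>)) \<partial>lborel)"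
    by (rule nn_integral_log_polar_plane) measurable
  also have "(\<integral>\<^sup>+\<tau>. f (exp \<tau>) * ennreal (exp (2 * \<tau>)) \<partial>lborel)
      = (\<integral>\<^sup>+\<tau>. f (exp (-\<tau>)) * ennreal (exp (2 * -\<tau>)) \<partial>lborel)"
    by (subst nn_integral_real_affine[where c="-1" and t=0]) auto
  also have "\<dots> = (\<integral>\<^sup>+\<tau>. ennreal (exp (- (\<beta> + 2) * \<tau>)) * indicator {0..} \<tau> \<partial>lborel)"
    by (rule nn_integral_cong_AE, use AE_lborel_singleton[of "0::real"] in eventually_elim)
      (auto simp: f_def indicator_def ennreal_mult[symmetric] powr_def exp_add[symmetric] algebra_simps)
  also have "\<dots> = ennreal (1 / (\<beta> + 2))"
    by (subst nn_integral_exp_atLeast) (use assms in auto)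
  also have "ennreal (2 * pi) * \<dots> = ennreal (2 * pi / (\<beta> + 2))"
    using assms by (simp add: ennreal_mult[symmetric])
  finally show ?thesis .
qed

text \<open>This is the squared L^2 norm of 1 / |y| on a shell, the factor split off by
  Cauchy-Schwarz; the logarithm in the radial bound originates here.\<close>

lemma nn_integral_shell_inverse_square:
  assumes "0 < a" "a < 1"
  shows "(\<integral>\<^sup>+x. indicator {a..<1} (norm x) * ennreal (1 / (norm x)\<^sup>2) \<partial>(lborel :: (real^2) measure))
    = ennreal (2 * pi * ln (1 / a))"
proof -
  have "(\<integral>\<^sup>+x. indicator {a..<1} (norm x) * ennreal (1 / (norm x)\<^sup>2) \<partial>(lborel :: (real^2) measure))
      = ennreal (2 * pi) * (\<integral>\<^sup>+\<tau>. indicator {a..<1} (exp \<tau>) \<partial>lborel)"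
    using nn_integral_log_polar[where ?'a = "real^2" and f = "indicator {a..<1}"]
    by (simp add: unit_ball_vol_2)
  also have "(\<integral>\<^sup>+\<tau>. indicator {a..<1} (exp \<tau>) \<partial>lborel) = (\<integral>\<^sup>+\<tau>. indicator {ln a..<0} \<tau> \<partial>lborel)"
  proof (intro nn_integral_cong)
    fix \<tau> :: real
    have "a \<le> exp \<tau> \<longleftrightarrow> ln a \<le> \<tau>" using assms by (metis exp_le_cancel_iff exp_ln)
    then show "indicator {a..<1} (exp \<tau>) = (indicator {ln a..<0} \<tau> :: ennreal)"
      by (simp add: indicator_def)
  qed
  also have "\<dots> = ennreal (ln (1 / a))"
    using assms by (simp add: ln_div)
  finally show ?thesis using assms ennreal_mult[of "2 * pi" "ln (1 / a)"] by (simp add: ln_div)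
qed

text \<open>Fubini and dilation by exp \<tau> make y = exp \<tau> x the variable. For fixed y, the
  \<tau> with exp (-\<tau>) |y| in T have total mass, under the Jacobian exp (-2 \<tau>), at most
  area / (2 pi |y|^2), where the area is that of the points with norm in T. Rays run outwards, so no
  y with |y| < a is met. T is an arbitrary Borel set because it will later be a superlevel set of
  the profile.\<close>

lemma nn_integral_rays_le:
  fixes F :: "real^2 \<Rightarrow> ennreal"
  assumes [measurable]: "F \<in> borel_measurable borel" "T \<in> sets borel"
    and a: "a > 0" "T \<subseteq> {a..}"
  shows "(\<integral>\<^sup>+x. indicator T (norm x) * (\<integral>\<^sup>+\<tau>. indicator {0..} \<tau> * F (exp \<tau> *\<^sub>R x) \<partial>lborel) \<partial>lborel)
    \<le> ennreal (1 / (2 * pi)) * (\<integral>\<^sup>+x. indicator T (norm (x::real^2)) \<partial>lborel)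
       * (\<integral>\<^sup>+y. indicator {a..} (norm y) * ennreal (1 / (norm y)\<^sup>2) * F y \<partial>lborel)"
proof -
  define m where "m = (\<integral>\<^sup>+x. indicator T (norm (x::real^2)) \<partial>lborel)"
  have m: "m = ennreal (2 * pi) * (\<integral>\<^sup>+\<tau>. indicator T (exp \<tau>) * ennreal (exp (2 * \<tau>)) \<partial>lborel)"
    unfolding m_def by (rule nn_integral_log_polar_plane) measurable
  have "(\<integral>\<^sup>+x. indicator T (norm x) * (\<integral>\<^sup>+\<tau>. indicator {0..} \<tau> * F (exp \<tau> *\<^sub>R x) \<partial>lborel) \<partial>lborel)
    = (\<integral>\<^sup>+x. (\<integral>\<^sup>+\<tau>. indicator T (norm x) * (indicator {0..} \<tau> * F (exp \<tau> *\<^sub>R x)) \<partial>lborel) \<partial>lborel)"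
    by (intro nn_integral_cong nn_integral_cmult[symmetric]) measurable
  also have "\<dots> = (\<integral>\<^sup>+\<tau>. (\<integral>\<^sup>+x. indicator T (norm x) * (indicator {0..} \<tau> * F (exp \<tau> *\<^sub>R x)) \<partial>lborel) \<partial>lborel)"
    by (rule lborel_pair.Fubini') measurable
  also have "\<dots> = (\<integral>\<^sup>+\<tau>. ennreal (exp (- 2 * \<tau>)) * (\<integral>\<^sup>+y. indicator T (exp (-\<tau>) * norm y) *
      (indicator {0..} \<tau> * F y) \<partial>lborel) \<partial>lborel)"
  proof (rule nn_integral_cong)
    fix \<tau> :: real
    show "(\<integral>\<^sup>+x. indicator T (norm x) * (indicator {0..} \<tau> * F (exp \<tau> *\<^sub>R x)) \<partial>lborel)
      = ennreal (exp (- 2 * \<tau>)) * (\<integral>\<^sup>+y. indicator T (exp (-\<tau>) * norm y) *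
      (indicator {0..} \<tau> * F y) \<partial>lborel)"
      using nn_integral_lborel_dilation[of "\<lambda>y. indicator T (exp (-\<tau>) * norm y) * (indicator {0..} \<tau> * F y)" "exp \<tau>"]
      by (simp add: mult.assoc[symmetric] exp_add[symmetric] exp_double[symmetric] exp_minus inverse_eq_divide)
  qed
  also have "\<dots> = (\<integral>\<^sup>+\<tau>. (\<integral>\<^sup>+y. ennreal (exp (- 2 * \<tau>)) * (indicator T (exp (-\<tau>) * norm y) *
      (indicator {0..} \<tau> * F y)) \<partial>lborel) \<partial>lborel)"
    by (intro nn_integral_cong nn_integral_cmult[symmetric]) measurable
  also have "\<dots> = (\<integral>\<^sup>+y. (\<integral>\<^sup>+\<tau>. ennreal (exp (- 2 * \<tau>)) * (indicator T (exp (-\<tau>) * norm y) *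
      (indicator {0..} \<tau> * F y)) \<partial>lborel) \<partial>lborel)"
    by (rule lborel_pair.Fubini') measurable
  also have "\<dots> \<le> (\<integral>\<^sup>+y. ennreal (1 / (2 * pi)) * m * (indicator {a..} (norm y) * ennreal (1 / (norm y)\<^sup>2) * F y) \<partial>lborel)"
  proof (rule nn_integral_mono_AE, use AE_lborel_singleton[of "0::real^2"] in eventually_elim)
    case (elim y)
    define K where "K = (\<integral>\<^sup>+\<tau>. ennreal (exp (- 2 * \<tau>)) * (indicator T (exp (-\<tau>) * norm y) * indicator {0..} \<tau>) \<partial>lborel)"
    have "(\<integral>\<^sup>+\<tau>. ennreal (exp (- 2 * \<tau>)) * (indicator T (exp (-\<tau>) * norm y) * (indicator {0..} \<tau> * F y)) \<partial>lborel) = K * F y"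
      unfolding K_def by (subst nn_integral_multc[symmetric]) (auto simp: mult_ac)
    moreover have "K \<le> ennreal (1 / (2 * pi)) * m * (indicator {a..} (norm y) * ennreal (1 / (norm y)\<^sup>2))"
    proof (cases "norm y < a")
      case True
      have "exp (-\<tau>) * norm y \<notin> T" if "\<tau> \<ge> 0" for \<tau>
      proof -
        have "exp (-\<tau>) * norm y \<le> 1 * norm y" using that by (intro mult_right_mono) auto
        then show ?thesis using True a by fastforce
      qed
      then have "K = (\<integral>\<^sup>+\<tau>. 0 \<partial>(lborel :: real measure))"
        unfolding K_def by (intro nn_integral_cong) (auto simp: indicator_def)
      then show ?thesis by simp
    next
      case False
      \<comment> \<open>Dropping the constraint \<tau> >= 0 turns the integral into one over the
        whole line, where a reflection and shift by ln |y| express it through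
        \<open>m\<close>.\<close>
      define J where "J = (\<integral>\<^sup>+\<tau>. ennreal (exp (- 2 * \<tau>)) * indicator T (exp (-\<tau>) * norm y) \<partial>lborel)"
      have "K \<le> J" unfolding K_def J_def by (intro nn_integral_mono) (auto simp: indicator_def)
      have "(\<integral>\<^sup>+\<tau>. indicator T (exp \<tau>) * ennreal (exp (2 * \<tau>)) \<partial>lborel)
        = (\<integral>\<^sup>+\<tau>. indicator T (exp (ln (norm y) - \<tau>)) * ennreal (exp (2 * (ln (norm y) - \<tau>))) \<partial>lborel)"
        by (subst nn_integral_real_affine[where c="-1" and t="ln (norm y)"]) auto
      also have "\<dots> = (\<integral>\<^sup>+\<tau>. ennreal ((norm y)\<^sup>2) * (ennreal (exp (- 2 * \<tau>)) * indicator T (exp (-\<tau>) * norm y)) \<partial>lborel)"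
      proof (intro nn_integral_cong)
        fix \<tau> :: real
        have 1: "exp (ln (norm y) - \<tau>) = exp (-\<tau>) * norm y"
          using elim by (simp add: exp_diff exp_minus field_simps)
        have "exp (2 * (ln (norm y) - \<tau>)) = (exp (ln (norm y) - \<tau>))\<^sup>2"
          by (rule exp_double)
        also have "\<dots> = (norm y)\<^sup>2 * exp (- 2 * \<tau>)"
          unfolding 1 by (simp add: power_mult_distrib exp_double[symmetric] mult.commute)
        finally show "indicator T (exp (ln (norm y) - \<tau>)) * ennreal (exp (2 * (ln (norm y) - \<tau>)))
          = ennreal ((norm y)\<^sup>2) * (ennreal (exp (- 2 * \<tau>)) * indicator T (exp (-\<tau>) * norm y))"
          unfolding 1 by (simp add: ennreal_mult mult_ac)
      qed
      also have "\<dots> = ennreal ((norm y)\<^sup>2) * J"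
        unfolding J_def by (rule nn_integral_cmult) measurable
      finally have "m = ennreal (2 * pi) * (ennreal ((norm y)\<^sup>2) * J)"
        using m by simp
      then have "ennreal (1 / (2 * pi)) * m * ennreal (1 / (norm y)\<^sup>2)
        = ennreal (1 / (2 * pi) * (2 * pi) * ((norm y)\<^sup>2 * (1 / (norm y)\<^sup>2))) * J"
        by (simp add: ennreal_mult mult_ac del: times_divide_eq_left times_divide_eq_right)
      also have "\<dots> = J" using elim by simp
      finally show ?thesis using False \<open>K \<le> J\<close> by simp
    qed
    ultimately show ?case by (simp add: mult.assoc[symmetric] mult_right_mono)
  qed
  also have "\<dots> = ennreal (1 / (2 * pi)) * m * (\<integral>\<^sup>+y. indicator {a..} (norm y) * ennreal (1 / (norm y)\<^sup>2) * F y \<partial>lborel)"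
    by (rule nn_integral_cmult) measurable
  finally show ?thesis unfolding m_def .
qed

subsection \<open>Integration along rays\<close>

lemma unit_ball_borel [measurable]: "unit_ball \<in> sets borel"
  by (simp add: unit_ball_def)

lemma test_fun_continuous:
  assumes "test_fun \<phi> g"
  shows "continuous_on UNIV \<phi>" "continuous_on UNIV g"
  using assms unfolding test_fun_def
  by (auto intro!: continuous_at_imp_continuous_on has_derivative_continuous)

lemma test_fun_measurable [measurable_dest]:
  assumes "test_fun \<phi> g"
  shows "\<phi> \<in> borel_measurable borel" "g \<in> borel_measurable borel"
  using test_fun_continuous[OF assms] by (auto intro: borel_measurable_continuous_onI)

lemma test_fun_zero:
  assumes "test_fun \<phi> g" "norm x \<ge> 1"
  shows "\<phi> x = 0"
proof (rule ccontr)
  assume "\<phi> x \<noteq> 0"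
  then have "x \<in> closure {x. \<phi> x \<noteq> 0}" by (intro subsetD[OF closure_subset]) simp
  then show False using assms unfolding test_fun_def unit_ball_def by auto
qed

text \<open>Fundamental theorem of calculus along \<tau> -> exp \<tau> x, followed until it reaches
  the unit sphere, where \<phi> vanishes. The velocity of this curve is its own position, hence the
  second norm in the integrand.\<close>

lemma test_fun_le_ray:
  assumes t: "test_fun \<phi> g" and x: "x \<noteq> 0"
  shows "ennreal \<bar>\<phi> x\<bar> \<le> (\<integral>\<^sup>+\<tau>. indicator {0..} \<tau> * (indicator unit_ball (exp \<tau> *\<^sub>R x) *
    ennreal (norm (g (exp \<tau> *\<^sub>R x)) * norm (exp \<tau> *\<^sub>R x))) \<partial>lborel)"
proof (cases "norm x < 1")
  case False
  then show ?thesis using test_fun_zero[OF t, of x] by simp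
next
  case True
  define b where "b = - ln (norm x)"
  have b: "b > 0" using True x by (simp add: b_def)
  have eb: "exp b * norm x = 1" using x by (simp add: b_def exp_minus)
  define f where "f \<tau> = g (exp \<tau> *\<^sub>R x) \<bullet> (exp \<tau> *\<^sub>R x)" for \<tau>
  have gc: "continuous_on UNIV g" using t test_fun_continuous by auto
  have "continuous_on {0..b} f" unfolding f_def
    by (intro continuous_intros continuous_on_compose2[OF gc]) auto
  moreover have "((\<lambda>\<tau>. \<phi> (exp \<tau> *\<^sub>R x)) has_vector_derivative f \<tau>) (at \<tau> within {0..b})" for \<tau>
  proof -
    have 1: "((\<lambda>\<tau>. exp \<tau> *\<^sub>R x) has_derivative (\<lambda>h. (exp \<tau> * h) *\<^sub>R x)) (at \<tau> within {0..b})"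
      by (auto intro!: derivative_eq_intros simp: mult.commute)
    have 2: "(\<phi> has_derivative (\<lambda>h. g (exp \<tau> *\<^sub>R x) \<bullet> h)) (at (exp \<tau> *\<^sub>R x))"
      using t unfolding test_fun_def by auto
    show ?thesis
      unfolding has_vector_derivative_def f_def
      using has_derivative_compose[OF 1 2] by (simp add: mult_ac)
  qed
  ultimately have *: "has_bochner_integral lborel (\<lambda>\<tau>. indicator {0..b} \<tau> *\<^sub>R f \<tau>)
      (\<phi> (exp b *\<^sub>R x) - \<phi> (exp 0 *\<^sub>R x))"
    using b by (intro has_bochner_integral_FTC_Icc) auto
  have "\<phi> (exp b *\<^sub>R x) = 0" using eb by (intro test_fun_zero[OF t]) simp
  then have "ennreal \<bar>\<phi> x\<bar> = ennreal (norm (\<integral>\<tau>. indicator {0..b} \<tau> *\<^sub>R f \<tau> \<partial>lborel))"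
    using * by (simp add: has_bochner_integral_iff)
  also have "\<dots> \<le> (\<integral>\<^sup>+\<tau>. norm (indicator {0..b} \<tau> *\<^sub>R f \<tau>) \<partial>lborel)"
    using * by (intro integral_norm_bound_ennreal) (auto simp: has_bochner_integral_iff)
  also have "\<dots> \<le> (\<integral>\<^sup>+\<tau>. indicator {0..} \<tau> * (indicator unit_ball (exp \<tau> *\<^sub>R x) *
    ennreal (norm (g (exp \<tau> *\<^sub>R x)) * norm (exp \<tau> *\<^sub>R x))) \<partial>lborel)"
  \<comment> \<open>At \<tau> = b the ray sits on the sphere, outside the open ball, so that single
    time has to be discarded.\<close>
  proof (rule nn_integral_mono_AE, use AE_lborel_singleton[of b] in eventually_elim)
    case (elim \<tau>)
    show ?case
    proof (cases "\<tau> \<in> {0..b}")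
      case True
      then have "exp \<tau> * norm x < exp b * norm x" using elim x by simp
      then have "exp \<tau> *\<^sub>R x \<in> unit_ball" using eb by (simp add: unit_ball_def)
      moreover have "\<bar>f \<tau>\<bar> \<le> norm (g (exp \<tau> *\<^sub>R x)) * norm (exp \<tau> *\<^sub>R x)"
        unfolding f_def by (rule Cauchy_Schwarz_ineq2)
      ultimately show ?thesis using True by (simp add: ennreal_leI)
    qed auto
  qed
  finally show ?thesis .
qed

text \<open>The ray bound averaged over radii. The position factor |y| meets the weight 1 / |y|^2
  and leaves 1 / |y|. Both sides are of first order in \<phi> and g, so L^1 convergence will suffice
  to pass to the limit.\<close>

lemma test_fun_shell:
  assumes t: "test_fun \<phi> g" and [measurable]: "T \<in> sets borel" and a: "a > 0" "T \<subseteq> {a..}"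
  shows "(\<integral>\<^sup>+x. indicator T (norm x) * ennreal \<bar>\<phi> x\<bar> \<partial>lborel) \<le>
    ennreal (1 / (2 * pi)) * (\<integral>\<^sup>+x. indicator T (norm (x::real^2)) \<partial>lborel)
       * (\<integral>\<^sup>+y. indicator {a..<1} (norm y) * ennreal (norm (g y) / norm y) \<partial>lborel)"
proof -
  note [measurable] = test_fun_measurable[OF t]
  define F where "F y = indicator unit_ball y * ennreal (norm (g y) * norm y)" for y
  have [measurable]: "F \<in> borel_measurable borel" unfolding F_def by measurable
  have "(\<integral>\<^sup>+x. indicator T (norm x) * ennreal \<bar>\<phi> x\<bar> \<partial>lborel) \<le>
      (\<integral>\<^sup>+x. indicator T (norm x) * (\<integral>\<^sup>+\<tau>. indicator {0..} \<tau> * F (exp \<tau> *\<^sub>R x) \<partial>lborel) \<partial>lborel)"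
    by (rule nn_integral_mono_AE, use AE_lborel_singleton[of "0::real^2"] in eventually_elim)
      (use test_fun_le_ray[OF t] in \<open>auto simp: F_def intro!: mult_left_mono\<close>)
  also have "\<dots> \<le> ennreal (1 / (2 * pi)) * (\<integral>\<^sup>+x. indicator T (norm (x::real^2)) \<partial>lborel)
       * (\<integral>\<^sup>+y. indicator {a..} (norm y) * ennreal (1 / (norm y)\<^sup>2) * F y \<partial>lborel)"
    by (rule nn_integral_rays_le) (use a in auto)
  also have "(\<integral>\<^sup>+y. indicator {a..} (norm y) * ennreal (1 / (norm y)\<^sup>2) * F y \<partial>lborel)
      = (\<integral>\<^sup>+y. indicator {a..<1} (norm y) * ennreal (norm (g y) / norm y) \<partial>lborel)"
    using a by (intro nn_integral_cong)
      (auto simp: F_def unit_ball_def indicator_def ennreal_mult[symmetric] power2_eq_square)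
  finally show ?thesis .
qed

section \<open>Passage from test functions to H^1_0 by estimates on the disc\<close>

lemma borel_measurable_indicator_norm:
  fixes f :: "'a \<Rightarrow> 'b::euclidean_space"
  assumes "set_borel_measurable M A f"
  shows "(\<lambda>x. indicator A x * ennreal (norm (f x))) \<in> borel_measurable M"
proof -
  have "(\<lambda>x. indicator A x * ennreal (norm (f x))) = (\<lambda>x. ennreal (norm (indicator A x *\<^sub>R f x)))"
    by (auto simp: indicator_def)
  moreover have "\<dots> \<in> borel_measurable M"
    using assms[unfolded set_borel_measurable_def] by measurable
  ultimately show ?thesis by (simp only:)
qed

text \<open>The function f is only Lebesgue measurable while w is Borel. Nonnegative integrals agree
  for \<open>lborel\<close> and its completion, so the inequality is applied over
  \<open>lebesgue\<close> and stated over \<open>lborel\<close>, where Fubini and dilation are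
  used.\<close>

lemma Cauchy_Schwarz_unit_ball:
  fixes f :: "real^2 \<Rightarrow> 'b::euclidean_space"
  assumes f: "set_borel_measurable lebesgue unit_ball f"
    and i: "set_integrable lebesgue unit_ball (\<lambda>x. (norm (f x))\<^sup>2)"
    and w [measurable]: "w \<in> borel_measurable borel"
    and c: "(\<integral>\<^sup>+x. (w x)\<^sup>2 \<partial>lborel) = ennreal c" "c \<ge> 0"
  shows "(\<integral>\<^sup>+x. w x * (indicator unit_ball x * ennreal (norm (f x))) \<partial>lborel)
    \<le> ennreal (sqrt (c * (LINT x:unit_ball|lebesgue. (norm (f x))\<^sup>2)))"
proof -
  define I where "I = (LINT x:unit_ball|lebesgue. (norm (f x))\<^sup>2)"
  define X where "X = (\<integral>\<^sup>+x. w x * (indicator unit_ball x * ennreal (norm (f x))) \<partial>lborel)"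
  define h where "h x = indicator unit_ball x * ennreal (norm (f x))" for x
  have I0: "I \<ge> 0" unfolding I_def set_lebesgue_integral_def by (intro integral_nonneg_AE) auto
  have hm: "h \<in> borel_measurable lebesgue"
    unfolding h_def by (rule borel_measurable_indicator_norm[OF f])
  have wm: "w \<in> borel_measurable lebesgue" using w by (simp add: measurable_completion)
  have "X\<^sup>2 = (\<integral>\<^sup>+x. w x * h x \<partial>lebesgue)\<^sup>2"
    unfolding X_def h_def by (simp add: nn_integral_completion)
  also have "\<dots> \<le> (\<integral>\<^sup>+x. (w x)\<^sup>2 \<partial>lebesgue) * (\<integral>\<^sup>+x. (h x)\<^sup>2 \<partial>lebesgue)"
    by (rule Cauchy_Schwarz_nn_integral[OF wm hm])
  also have "(\<integral>\<^sup>+x. (w x)\<^sup>2 \<partial>lebesgue) = ennreal c" using c by (simp add: nn_integral_completion)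
  also have "(\<integral>\<^sup>+x. (h x)\<^sup>2 \<partial>lebesgue) = (\<integral>\<^sup>+x. ennreal (indicator unit_ball x *\<^sub>R (norm (f x))\<^sup>2) \<partial>lebesgue)"
    by (intro nn_integral_cong) (auto simp: h_def indicator_def ennreal_power)
  also have "\<dots> = ennreal I"
    unfolding I_def set_lebesgue_integral_def
    using i unfolding set_integrable_def by (intro nn_integral_eq_integral) auto
  also have "ennreal c * ennreal I = (ennreal (sqrt (c * I)))\<^sup>2"
    using c I0 by (simp add: ennreal_mult[symmetric] ennreal_power)
  finally have *: "X\<^sup>2 \<le> (ennreal (sqrt (c * I)))\<^sup>2" .
  \<comment> \<open>Extracting the square root needs X finite; an infinite X contradicts the bound
    on its square.\<close>
  have "X \<le> ennreal (sqrt (c * I))"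
  proof (cases X)
    case (real r)
    then have "ennreal (r\<^sup>2) \<le> ennreal ((sqrt (c * I))\<^sup>2)" using * c I0 by (simp add: ennreal_power)
    then have "r\<^sup>2 \<le> (sqrt (c * I))\<^sup>2" by (subst (asm) ennreal_le_iff) auto
    then have "r \<le> sqrt (c * I)" by (rule power2_le_imp_le) (use c I0 in auto)
    then show ?thesis using real by (simp add: ennreal_leI)
  next
    case top
    then show ?thesis using * by (simp add: ennreal_power top_unique power_eq_top_ennreal)
  qed
  then show ?thesis unfolding X_def I_def .
qed

text \<open>The limits in \<open>H10\<close> concern Bochner integrals, which are 0 for
  non-integrable functions. Integrability of the squared errors is what makes those limits express
  genuine L^2 convergence.\<close>

lemma diff_square_integrable_unit_ball:
  fixes f h :: "real^2 \<Rightarrow> 'b::euclidean_space"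
  assumes f: "continuous_on UNIV f"
    and h: "set_borel_measurable lebesgue unit_ball h"
    and i: "set_integrable lebesgue unit_ball (\<lambda>x. (norm (h x))\<^sup>2)"
  shows "set_borel_measurable lebesgue unit_ball (\<lambda>x. f x - h x)"
    and "set_integrable lebesgue unit_ball (\<lambda>x. (norm (f x - h x))\<^sup>2)"
proof -
  have fm: "f \<in> borel_measurable lebesgue"
    using borel_measurable_continuous_onI[OF f] by (simp add: measurable_completion)
  have ub: "unit_ball \<in> sets lebesgue" by (simp add: unit_ball_def)
  show *: "set_borel_measurable lebesgue unit_ball (\<lambda>x. f x - h x)"
    using h fm ub unfolding set_borel_measurable_def by (simp add: scaleR_diff_right borel_measurable_diff borel_measurable_scaleR borel_measurable_indicator)
  have m: "set_borel_measurable lebesgue unit_ball (\<lambda>x. (norm (f x - h x))\<^sup>2)"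
  proof -
    have "(\<lambda>x. indicator unit_ball x *\<^sub>R (norm (f x - h x))\<^sup>2) = (\<lambda>x. (norm (indicator unit_ball x *\<^sub>R (f x - h x)))\<^sup>2)"
      by (auto simp: indicator_def)
    moreover have "\<dots> \<in> borel_measurable lebesgue"
      using *[unfolded set_borel_measurable_def] by measurable
    ultimately show ?thesis unfolding set_borel_measurable_def by (simp only:)
  qed
  have "set_integrable lborel (cball 0 1) (\<lambda>x. (norm (f x))\<^sup>2)"
    unfolding set_integrable_def
    by (intro borel_integrable_compact continuous_intros continuous_on_subset[OF f]) auto
  then have "set_integrable lborel unit_ball (\<lambda>x. (norm (f x))\<^sup>2)"
    by (rule set_integrable_subset) (auto simp: unit_ball_def)
  then have "set_integrable lebesgue unit_ball (\<lambda>x. (norm (f x))\<^sup>2)"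
    unfolding set_integrable_def using borel_measurable_continuous_onI[OF f]
    by (subst integrable_completion) auto
  then have "set_integrable lebesgue unit_ball (\<lambda>x. 2 * (norm (f x))\<^sup>2 + 2 * (norm (h x))\<^sup>2)"
    using i by (intro set_integral_add set_integrable_mult_right) auto
  then show "set_integrable lebesgue unit_ball (\<lambda>x. (norm (f x - h x))\<^sup>2)"
  proof (rule set_integrable_bound[OF _ m])
    have "(norm (f x - h x))\<^sup>2 \<le> 2 * (norm (f x))\<^sup>2 + 2 * (norm (h x))\<^sup>2" for x
    proof -
      have "(norm (f x - h x))\<^sup>2 \<le> (norm (f x) + norm (h x))\<^sup>2"
        by (intro power_mono norm_triangle_ineq4) auto
      also have "\<dots> \<le> 2 * (norm (f x))\<^sup>2 + 2 * (norm (h x))\<^sup>2"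
        using sum_squares_bound[of "norm (f x)" "norm (h x)"] by (simp add: power2_sum)
      finally show ?thesis .
    qed
    then show "AE x in lebesgue. x \<in> unit_ball \<longrightarrow>
        norm ((norm (f x - h x))\<^sup>2) \<le> norm (2 * (norm (f x))\<^sup>2 + 2 * (norm (h x))\<^sup>2)"
      by (auto intro!: always_eventually)
  qed
qed

text \<open>Cauchy-Schwarz against the indicator of the disc, whose squared L^2 norm is pi.\<close>

lemma L2_imp_L1_tendsto_unit_ball:
  fixes f :: "nat \<Rightarrow> real^2 \<Rightarrow> 'b::euclidean_space"
  assumes f: "\<And>n. continuous_on UNIV (f n)"
    and h: "set_borel_measurable lebesgue unit_ball h"
    and i: "set_integrable lebesgue unit_ball (\<lambda>x. (norm (h x))\<^sup>2)"
    and lim: "(\<lambda>n. LINT x:unit_ball|lebesgue. (norm (f n x - h x))\<^sup>2) \<longlonglongrightarrow> 0"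
  shows "(\<lambda>n. \<integral>\<^sup>+x. indicator unit_ball x * ennreal (norm (f n x - h x)) \<partial>lborel) \<longlonglongrightarrow> 0"
proof (rule tendsto_sandwich[OF _ _ tendsto_const])
  have "(\<lambda>n. ennreal (sqrt (pi * (LINT x:unit_ball|lebesgue. (norm (f n x - h x))\<^sup>2)))) \<longlonglongrightarrow> ennreal (sqrt (pi * 0))"
    by (intro tendsto_intros lim)
  then show "(\<lambda>n. ennreal (sqrt (pi * (LINT x:unit_ball|lebesgue. (norm (f n x - h x))\<^sup>2)))) \<longlonglongrightarrow> 0" by simp
  have w: "(\<integral>\<^sup>+x. (indicator unit_ball x)\<^sup>2 \<partial>lborel) = ennreal pi"
  proof -
    have "(\<integral>\<^sup>+x. (indicator unit_ball x)\<^sup>2 \<partial>lborel) = (\<integral>\<^sup>+x. indicator unit_ball x \<partial>lborel)"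
      by (intro nn_integral_cong) (auto simp: indicator_def)
    then show ?thesis by (simp add: unit_ball_def emeasure_ball unit_ball_vol_2)
  qed
  show "\<forall>\<^sub>F n in sequentially. (\<integral>\<^sup>+x. indicator unit_ball x * ennreal (norm (f n x - h x)) \<partial>lborel)
      \<le> ennreal (sqrt (pi * (LINT x:unit_ball|lebesgue. (norm (f n x - h x))\<^sup>2)))"
  proof (intro always_eventually allI)
    fix n
    have "(\<integral>\<^sup>+x. indicator unit_ball x * ennreal (norm (f n x - h x)) \<partial>lborel) =
      (\<integral>\<^sup>+x. indicator unit_ball x * (indicator unit_ball x * ennreal (norm (f n x - h x))) \<partial>lborel)"
      by (intro nn_integral_cong) (auto simp: indicator_def)
    also have "\<dots> \<le> ennreal (sqrt (pi * (LINT x:unit_ball|lebesgue. (norm (f n x - h x))\<^sup>2)))"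
      by (intro Cauchy_Schwarz_unit_ball diff_square_integrable_unit_ball f h i w) auto
    finally show "(\<integral>\<^sup>+x. indicator unit_ball x * ennreal (norm (f n x - h x)) \<partial>lborel)
      \<le> ennreal (sqrt (pi * (LINT x:unit_ball|lebesgue. (norm (f n x - h x))\<^sup>2)))" .
  qed
qed auto

lemma dirichlet_nonneg: "dirichlet G \<ge> 0"
  unfolding dirichlet_def set_lebesgue_integral_def by (intro integral_nonneg_AE) auto

text \<open>\<open>test_fun_shell\<close> passes to the limit: on a shell away from the origin both
  error terms are controlled in L^1. Cauchy-Schwarz with weight 1 / |y| then yields the Dirichlet
  integral. Radial symmetry is not assumed, so the bound also serves
  \<open>H10_dirichlet_zero\<close>.\<close>

lemma H10_shell:
  assumes H: "H10 u G" and T [measurable]: "T \<in> sets borel"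
    and a: "0 < a" "a < 1" "T \<subseteq> {a..<1}"
  shows "(\<integral>\<^sup>+x. indicator T (norm x) * ennreal \<bar>u x\<bar> \<partial>lborel) \<le>
    (\<integral>\<^sup>+x. indicator T (norm (x::real^2)) \<partial>lborel) * ennreal (sqrt (ln (1 / a) * (dirichlet G / (2 * pi))))"
proof -
  from H obtain \<phi> g where t: "\<And>n. test_fun (\<phi> n) (g n)"
    and l1: "(\<lambda>n. LINT x:unit_ball|lebesgue. (\<phi> n x - u x)\<^sup>2) \<longlonglongrightarrow> 0"
    and l2: "(\<lambda>n. LINT x:unit_ball|lebesgue. (norm (g n x - G x))\<^sup>2) \<longlonglongrightarrow> 0"
    and um: "set_borel_measurable lebesgue unit_ball u"
    and Gm: "set_borel_measurable lebesgue unit_ball G"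
    and ui: "set_integrable lebesgue unit_ball (\<lambda>x. (norm (u x))\<^sup>2)"
    and Gi: "set_integrable lebesgue unit_ball (\<lambda>x. (norm (G x))\<^sup>2)"
    unfolding H10_def by auto
  define m where "m = (\<integral>\<^sup>+x. indicator T (norm (x::real^2)) \<partial>lborel)"
  define \<kappa> where "\<kappa> = ennreal (1 / (2 * pi)) * m"
  have "m \<le> (\<integral>\<^sup>+x. indicator unit_ball x \<partial>lborel)"
    unfolding m_def using a by (intro nn_integral_mono) (auto simp: indicator_def unit_ball_def)
  also have "\<dots> < \<infinity>" by (simp add: unit_ball_def emeasure_ball)
  \<comment> \<open>Multiplication by a constant is continuous at 0 in \<open>ennreal\<close> only
    when the constant is finite.\<close>
  finally have \<kappa>: "\<kappa> < top" unfolding \<kappa>_def by (simp add: ennreal_mult_less_top)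
  define e where "e n = (\<integral>\<^sup>+x. indicator unit_ball x * ennreal (norm (\<phi> n x - u x)) \<partial>lborel)" for n
  define d where "d n = (\<integral>\<^sup>+x. indicator unit_ball x * ennreal (norm (g n x - G x)) \<partial>lborel)" for n
  have e: "e \<longlonglongrightarrow> 0" unfolding e_def
    using l1 by (intro L2_imp_L1_tendsto_unit_ball test_fun_continuous(1)[OF t] um ui) simp
  have d: "d \<longlonglongrightarrow> 0" unfolding d_def
    by (intro L2_imp_L1_tendsto_unit_ball test_fun_continuous(2)[OF t] Gm Gi l2)
  define I where "I = (\<integral>\<^sup>+y. indicator {a..<1} (norm y) * ennreal (norm (G y) / norm y) \<partial>lborel)"
  define A where "A = (\<integral>\<^sup>+x. indicator T (norm x) * ennreal \<bar>u x\<bar> \<partial>lborel)"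
  have A_le: "A \<le> \<kappa> * I + \<kappa> * ennreal (1 / a) * d n + e n" for n
  proof -
    note [measurable] = test_fun_measurable[OF t[of n]]
    have m1: "(\<lambda>x. indicator T (norm x) * ennreal \<bar>\<phi> n x\<bar>) \<in> borel_measurable lebesgue"
      by (intro measurable_completion) measurable
    have m2: "(\<lambda>x. indicator unit_ball x * ennreal (norm (\<phi> n x - u x))) \<in> borel_measurable lebesgue"
      by (intro borel_measurable_indicator_norm diff_square_integrable_unit_ball test_fun_continuous(1)[OF t] um ui)
    have m3: "(\<lambda>x. indicator unit_ball x * ennreal (norm (g n x - G x))) \<in> borel_measurable lebesgue"
      by (intro borel_measurable_indicator_norm diff_square_integrable_unit_ball test_fun_continuous(2)[OF t] Gm Gi)
    have m4: "(\<lambda>y. indicator {a..<1} (norm y) * ennreal (norm (G y) / norm y)) \<in> borel_measurable lebesgue"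
    proof -
      have "(\<lambda>y. indicator {a..<1} (norm y) * ennreal (norm (G y) / norm y)) =
          (\<lambda>y. (indicator {a..<1} (norm y) * ennreal (1 / norm y)) * (indicator unit_ball y * ennreal (norm (G y))))"
        by (auto simp: indicator_def unit_ball_def fun_eq_iff ennreal_mult[symmetric])
      moreover have "\<dots> \<in> borel_measurable lebesgue"
        by (intro borel_measurable_times_ennreal borel_measurable_indicator_norm Gm measurable_completion) measurable
      ultimately show ?thesis by (simp only:)
    qed
    have "A \<le> (\<integral>\<^sup>+x. indicator T (norm x) * ennreal \<bar>\<phi> n x\<bar> + indicator unit_ball x * ennreal (norm (\<phi> n x - u x)) \<partial>lebesgue)"
      unfolding A_def nn_integral_completion using a
      by (intro nn_integral_mono) (auto simp: indicator_def unit_ball_def ennreal_plus[symmetric] simp del: ennreal_plus intro!: ennreal_leI)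
    also have "\<dots> = (\<integral>\<^sup>+x. indicator T (norm x) * ennreal \<bar>\<phi> n x\<bar> \<partial>lborel) + e n"
      by (subst nn_integral_add[OF m1 m2]) (simp add: e_def nn_integral_completion)
    also have "(\<integral>\<^sup>+x. indicator T (norm x) * ennreal \<bar>\<phi> n x\<bar> \<partial>lborel)
        \<le> \<kappa> * (\<integral>\<^sup>+y. indicator {a..<1} (norm y) * ennreal (norm (g n y) / norm y) \<partial>lborel)"
      unfolding \<kappa>_def m_def using a by (intro test_fun_shell t) auto
    also have "(\<integral>\<^sup>+y. indicator {a..<1} (norm y) * ennreal (norm (g n y) / norm y) \<partial>lborel)
      \<le> (\<integral>\<^sup>+y. indicator {a..<1} (norm y) * ennreal (norm (G y) / norm y)
          + ennreal (1 / a) * (indicator unit_ball y * ennreal (norm (g n y - G y))) \<partial>lebesgue)"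
      unfolding nn_integral_completion
    proof (intro nn_integral_mono)
      fix y :: "real^2"
      \<comment> \<open>The gradient error is controlled only without weight; replacing 1 / |y| by 1
        / a is the reason for keeping away from the origin.\<close>
      have "norm (g n y) / norm y \<le> norm (G y) / norm y + 1 / a * norm (g n y - G y)" if "a \<le> norm y"
      proof -
        have "norm (g n y) / norm y \<le> (norm (G y) + norm (g n y - G y)) / norm y"
          using norm_triangle_sub[of "g n y" "G y"] by (intro divide_right_mono) auto
        also have "\<dots> = norm (G y) / norm y + norm (g n y - G y) / norm y" by (simp add: add_divide_distrib)
        also have "norm (g n y - G y) / norm y \<le> norm (g n y - G y) / a"
          using that a by (intro divide_left_mono) (auto intro!: mult_pos_pos)
        finally show ?thesis by simp
      qed
      then show "indicator {a..<1} (norm y) * ennreal (norm (g n y) / norm y) \<le>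
        indicator {a..<1} (norm y) * ennreal (norm (G y) / norm y)
          + ennreal (1 / a) * (indicator unit_ball y * ennreal (norm (g n y - G y)))"
        using a by (auto simp: indicator_def unit_ball_def ennreal_plus[symmetric] ennreal_mult[symmetric]
            simp del: ennreal_plus intro!: ennreal_leI)
    qed
    also have "\<dots> = I + ennreal (1 / a) * d n"
      using m3 m4 nn_integral_cmult[OF m3, of "ennreal (1 / a)"]
      by (subst nn_integral_add) (simp_all add: I_def d_def nn_integral_completion)
    finally show ?thesis by (simp add: distrib_left mult.assoc mult_left_mono add_right_mono)
  qed
  have "(\<lambda>n. \<kappa> * I + \<kappa> * ennreal (1 / a) * d n + e n) \<longlonglongrightarrow> \<kappa> * I + \<kappa> * ennreal (1 / a) * 0 + 0"
    using \<kappa> by (intro tendsto_add tendsto_const ennreal_tendsto_cmult d e) (auto simp: ennreal_mult_less_top)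
  then have "A \<le> \<kappa> * I"
    using A_le by (intro LIMSEQ_le_const[where X = "\<lambda>n. \<kappa> * I + \<kappa> * ennreal (1 / a) * d n + e n"]) auto
  also have "I \<le> ennreal (sqrt (2 * pi * ln (1 / a) * dirichlet G))"
  proof -
    define w where "w y = indicator {a..<1} (norm y) * ennreal (1 / norm y)" for y :: "real^2"
    have "I = (\<integral>\<^sup>+y. w y * (indicator unit_ball y * ennreal (norm (G y))) \<partial>lborel)"
      unfolding I_def w_def
      by (intro nn_integral_cong) (auto simp: indicator_def unit_ball_def ennreal_mult[symmetric])
    also have "\<dots> \<le> ennreal (sqrt (2 * pi * ln (1 / a) * dirichlet G))"
      unfolding dirichlet_def
    proof (intro Cauchy_Schwarz_unit_ball Gm Gi)
      show "w \<in> borel_measurable borel" unfolding w_def by measurable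
      have "(\<integral>\<^sup>+x. (w x)\<^sup>2 \<partial>lborel) =
        (\<integral>\<^sup>+x. indicator {a..<1} (norm x) * ennreal (1 / (norm x)\<^sup>2) \<partial>(lborel :: (real^2) measure))"
        unfolding w_def by (intro nn_integral_cong) (auto simp: indicator_def ennreal_power power_divide)
      then show "(\<integral>\<^sup>+x. (w x)\<^sup>2 \<partial>lborel) = ennreal (2 * pi * ln (1 / a))"
        using nn_integral_shell_inverse_square a by simp
      show "0 \<le> 2 * pi * ln (1 / a)"
        by (intro mult_nonneg_nonneg ln_ge_zero) (use a in auto)
    qed
    finally show ?thesis .
  qed
  also have "\<kappa> * ennreal (sqrt (2 * pi * ln (1 / a) * dirichlet G)) =
      m * ennreal (1 / (2 * pi) * sqrt (2 * pi * ln (1 / a) * dirichlet G))"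
  proof -
    have "0 \<le> sqrt (2 * pi * ln (1 / a) * dirichlet G)"
      by (intro real_sqrt_ge_zero mult_nonneg_nonneg ln_ge_zero dirichlet_nonneg) (use a in auto)
    then have "ennreal (1 / (2 * pi) * sqrt (2 * pi * ln (1 / a) * dirichlet G))
        = ennreal (1 / (2 * pi)) * ennreal (sqrt (2 * pi * ln (1 / a) * dirichlet G))"
      by (intro ennreal_mult) auto
    then show ?thesis unfolding \<kappa>_def by (simp only: mult_ac)
  qed
  also have "1 / (2 * pi) * sqrt (2 * pi * ln (1 / a) * dirichlet G) = sqrt (ln (1 / a) * (dirichlet G / (2 * pi)))"
  proof -
    have "1 / (2 * pi) = sqrt ((1 / (2 * pi))\<^sup>2)" by simp
    then have "1 / (2 * pi) * sqrt (2 * pi * ln (1 / a) * dirichlet G)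
        = sqrt ((1 / (2 * pi))\<^sup>2 * (2 * pi * ln (1 / a) * dirichlet G))"
      by (metis real_sqrt_mult)
    also have "(1 / (2 * pi))\<^sup>2 * (2 * pi * ln (1 / a) * dirichlet G) = ln (1 / a) * (dirichlet G / (2 * pi))"
      by (simp add: power2_eq_square field_simps)
    finally show ?thesis .
  qed
  finally show ?thesis by (simp add: A_def m_def mult_left_mono)
qed

text \<open>With zero energy the bound of \<open>H10_shell\<close> vanishes on every shell, and
  countably many shells exhaust the punctured disc. It will exclude a groundstate with S =
  0.\<close>

lemma H10_dirichlet_zero:
  assumes H: "H10 u G" and D: "dirichlet G = 0"
  shows "AE x in lebesgue. x \<in> unit_ball \<longrightarrow> u x = 0"
proof -
  have um: "set_borel_measurable lebesgue unit_ball u" using H unfolding H10_def by auto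
  \<comment> \<open>The double successor keeps the inner radius strictly below 1, as
    \<open>H10_shell\<close> requires.\<close>
  have "AE x in lebesgue. 1 / real (Suc (Suc n)) \<le> norm x \<longrightarrow> x \<in> unit_ball \<longrightarrow> u x = 0" for n
  proof -
    define T where "T = {1 / real (Suc (Suc n))..<1}"
    have [measurable]: "T \<in> sets borel" by (simp add: T_def)
    have "(\<integral>\<^sup>+x. indicator T (norm x) * (indicator unit_ball x * ennreal (norm (u x))) \<partial>lebesgue)
        = (\<integral>\<^sup>+x. indicator T (norm x) * ennreal \<bar>u x\<bar> \<partial>lborel)"
      unfolding nn_integral_completion
      by (intro nn_integral_cong) (auto simp: T_def indicator_def unit_ball_def)
    also have "\<dots> \<le> 0"
      using H10_shell[OF H, of T "1 / real (Suc (Suc n))"] D by (auto simp: T_def)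
    finally have "(\<integral>\<^sup>+x. indicator T (norm x) * (indicator unit_ball x * ennreal (norm (u x))) \<partial>lebesgue) = 0"
      by simp
    moreover have "(\<lambda>x. indicator T (norm x) * (indicator unit_ball x * ennreal (norm (u x)))) \<in> borel_measurable lebesgue"
      by (intro borel_measurable_times_ennreal borel_measurable_indicator_norm um measurable_completion) measurable
    ultimately have "AE x in lebesgue. indicator T (norm x) * (indicator unit_ball x * ennreal (norm (u x))) = 0"
      by (simp add: nn_integral_0_iff_AE)
    then show ?thesis
      by eventually_elim (auto simp: T_def indicator_def unit_ball_def split: if_splits)
  qed
  then have "AE x in lebesgue. \<forall>n. 1 / real (Suc (Suc n)) \<le> norm x \<longrightarrow> x \<in> unit_ball \<longrightarrow> u x = 0"
    unfolding AE_all_countable by blast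
  moreover have "AE x in lebesgue. x \<noteq> (0::real^2)"
    unfolding AE_completion_iff by (rule AE_lborel_singleton)
  ultimately show ?thesis
  proof eventually_elim
    case (elim x)
    then obtain n where "1 / real (Suc n) < norm x" using nat_approx_posE[of "norm x"] by auto
    moreover have "1 / real (Suc (Suc n)) \<le> 1 / real (Suc n)" by (simp add: frac_le)
    ultimately have "1 / real (Suc (Suc n)) \<le> norm x" by linarith
    then show ?case using elim by blast
  qed
qed

subsection \<open>The radial estimate\<close>

text \<open>The profile in \<open>radial\<close> is an arbitrary function. By Tonelli almost every ray meets a given
  null set in a null set, so restricting a Borel version of \<open>u\<close> to a good ray yields a Borel profile.\<close>
lemma radial_borel_profile:
  assumes um: "set_borel_measurable lebesgue unit_ball u" and r: "radial u"
  obtains h where "h \<in> borel_measurable borel" "AE x in lborel. x \<in> unit_ball \<longrightarrow> u x = h (norm x)"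
proof -
  obtain v where v [measurable]: "v \<in> borel_measurable lborel"
    and uv: "AE x in lborel. indicator unit_ball x *\<^sub>R u x = v x"
    using completion_ex_borel_measurable_real[OF um[unfolded set_borel_measurable_def]] by auto
  obtain f where f: "AE x in lborel. x \<in> unit_ball \<longrightarrow> u x = f (norm x)"
    using r unfolding radial_def AE_completion_iff by auto
  have "AE x in lborel. x \<in> unit_ball \<longrightarrow> u x = v x \<and> v x = f (norm x)"
    using uv f by eventually_elim (auto simp: indicator_def)
  then obtain N where N: "{x. \<not> (x \<in> unit_ball \<longrightarrow> u x = v x \<and> v x = f (norm x))} \<subseteq> N"
    "emeasure lborel N = 0" and [measurable]: "N \<in> sets borel"
    by (auto elim!: AE_E)
  have "(\<integral>\<^sup>+x. (\<integral>\<^sup>+\<tau>. indicator N (exp \<tau> *\<^sub>R x) \<partial>lborel) \<partial>lborel) =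
      (\<integral>\<^sup>+\<tau>. (\<integral>\<^sup>+x. indicator N (exp \<tau> *\<^sub>R x) \<partial>lborel) \<partial>lborel)"
    by (rule lborel_pair.Fubini') measurable
  also have "\<dots> = (\<integral>\<^sup>+\<tau>. 0 \<partial>(lborel :: real measure))"
    by (intro nn_integral_cong, subst nn_integral_lborel_dilation) (auto simp: N)
  finally have "(\<integral>\<^sup>+x. (\<integral>\<^sup>+\<tau>. indicator N (exp \<tau> *\<^sub>R x) \<partial>lborel) \<partial>lborel) = 0" by simp
  then have "AE x in lborel. (\<integral>\<^sup>+\<tau>. indicator N (exp \<tau> *\<^sub>R x) \<partial>lborel) = 0"
    by (subst (asm) nn_integral_0_iff_AE) measurable
  with AE_lborel_singleton[of "0::real^2"]
  have "AE x in lborel. x \<noteq> 0 \<and> (\<integral>\<^sup>+\<tau>. indicator N (exp \<tau> *\<^sub>R x) \<partial>lborel) = 0"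
    by eventually_elim auto
  moreover have "ae_filter (lborel :: (real^2) measure) \<noteq> bot"
    by (simp add: ae_filter_eq_bot_iff)
  ultimately obtain z where z: "z \<noteq> 0" "(\<integral>\<^sup>+\<tau>. indicator N (exp \<tau> *\<^sub>R z) \<partial>lborel) = 0"
    using eventually_happens' by blast
  define h where "h s = v ((s / norm z) *\<^sub>R z)" for s
  have h: "h \<in> borel_measurable borel" unfolding h_def by measurable
  define Z where "Z = {s. (s / norm z) *\<^sub>R z \<in> N}"
  have [measurable]: "Z \<in> sets borel"
  proof -
    have "Z = (\<lambda>s. (s / norm z) *\<^sub>R z) -` N \<inter> space borel" by (auto simp: Z_def)
    also have "\<dots> \<in> sets borel" by (rule measurable_sets[of _ borel borel]) measurable
    finally show ?thesis .
  qed
  \<comment> \<open>A shift in \<tau> rescales z to unit length. Nullity along this one ray becomes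
    nullity of the set Z of radii, and log-polar coordinates spread it to all points with norm in
    Z.\<close>
  have "(\<integral>\<^sup>+\<tau>. indicator N (exp \<tau> *\<^sub>R z) \<partial>lborel) = (\<integral>\<^sup>+\<tau>. indicator N (exp (\<tau> + - ln (norm z)) *\<^sub>R z) \<partial>lborel)"
    by (rule nn_integral_lborel_shift[symmetric]) measurable
  also have "\<dots> = (\<integral>\<^sup>+\<tau>. indicator Z (exp \<tau>) \<partial>lborel)"
    using z(1) by (intro nn_integral_cong) (auto simp: Z_def indicator_def exp_diff)
  finally have "(\<integral>\<^sup>+\<tau>. indicator Z (exp \<tau>) \<partial>lborel) = 0" using z by simp
  then have "AE \<tau> in lborel. exp \<tau> \<notin> Z"
    by (subst (asm) nn_integral_0_iff_AE) (auto simp: indicator_def)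
  then have "(\<integral>\<^sup>+\<tau>. indicator Z (exp \<tau>) * ennreal (exp (2 * \<tau>)) \<partial>lborel) = 0"
    by (subst nn_integral_0_iff_AE) (auto simp: indicator_def)
  then have "(\<integral>\<^sup>+x. indicator Z (norm x) \<partial>(lborel :: (real^2) measure)) = 0"
    using nn_integral_log_polar_plane[of "indicator Z"] by simp
  then have "AE x in lborel. norm (x::real^2) \<notin> Z"
    by (subst (asm) nn_integral_0_iff_AE) (auto simp: indicator_def)
  moreover have "AE x in lborel. x \<notin> N"
    using N by (intro AE_not_in) (auto simp: null_sets_def)
  ultimately have "AE x in lborel. x \<in> unit_ball \<longrightarrow> u x = h (norm x)"
  proof eventually_elim
    case (elim x)
    show ?case
    proof
      assume x: "x \<in> unit_ball"
      define y where "y = (norm x / norm z) *\<^sub>R z"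
      have ny: "norm y = norm x" using z by (simp add: y_def)
      have "y \<notin> N" using elim by (simp add: Z_def y_def)
      moreover have "y \<in> unit_ball" using x ny by (simp add: unit_ball_def)
      ultimately have "v y = f (norm x)" using N(1) ny by auto
      moreover have "u x = f (norm x)" using x elim N(1) by auto
      ultimately show "u x = h (norm x)" by (simp add: h_def y_def)
    qed
  qed
  with h show ?thesis by (rule that)
qed

text \<open>For a radial function an average over a set of radii is as good as a pointwise bound:
  were |h| > M on a non-null set of radii, the average over that very set would exceed M, against
  \<open>H10_shell\<close>. This gives the bound with ln (1 / a) on the shell from a to 1, and a
  then increases to |x|.\<close>

lemma H10_radial_bound:
  assumes H: "H10 u G" and r: "radial u"
  shows "AE x in lborel. x \<in> unit_ball \<longrightarrow> (u x)\<^sup>2 \<le> ln (1 / norm x) * (dirichlet G / (2 * pi))"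
proof -
  define K where "K = dirichlet G / (2 * pi)"
  have K: "K \<ge> 0" using dirichlet_nonneg[of G] by (simp add: K_def)
  have "set_borel_measurable lebesgue unit_ball u" using H unfolding H10_def by auto
  then obtain h where h [measurable]: "h \<in> borel_measurable borel"
    and uh: "AE x in lborel. x \<in> unit_ball \<longrightarrow> u x = h (norm x)"
    using r by (rule radial_borel_profile)
  have shell: "AE x in lborel. norm (x::real^2) \<in> {a..<1} \<longrightarrow> (h (norm x))\<^sup>2 \<le> ln (1 / a) * K"
    if a: "0 < a" "a < 1" for a
  proof -
    define M where "M = sqrt (ln (1 / a) * K)"
    have LK: "ln (1 / a) * K \<ge> 0" by (intro mult_nonneg_nonneg ln_ge_zero K) (use a in auto)
    then have M: "M \<ge> 0" by (simp add: M_def)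
    define T where "T = {s. a \<le> s \<and> s < 1 \<and> \<bar>h s\<bar> > M}"
    have [measurable]: "T \<in> sets borel" unfolding T_def by measurable
    define m where "m = (\<integral>\<^sup>+x. indicator T (norm (x::real^2)) \<partial>lborel)"
    have "m \<le> (\<integral>\<^sup>+x. indicator unit_ball x \<partial>lborel)"
      unfolding m_def by (intro nn_integral_mono) (auto simp: T_def indicator_def unit_ball_def)
    also have "\<dots> < \<infinity>" by (simp add: unit_ball_def emeasure_ball)
    finally have m: "m < top" by simp
    \<comment> \<open>P is the excess over M on the bad set. Since \<open>m * ennreal M\<close> is
      finite it can be cancelled, which forces the excess to be 0 almost everywhere.\<close>
    define P where "P s = indicator T s * ennreal (\<bar>h s\<bar> - M)" for s
    have [measurable]: "P \<in> borel_measurable borel" unfolding P_def by measurable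
    have "(\<integral>\<^sup>+x. P (norm x) \<partial>(lborel :: (real^2) measure)) + m * ennreal M
      = (\<integral>\<^sup>+x. P (norm x) + indicator T (norm x) * ennreal M \<partial>(lborel :: (real^2) measure))"
      unfolding m_def by (subst nn_integral_add) (auto simp: nn_integral_multc)
    also have "\<dots> = (\<integral>\<^sup>+x. indicator T (norm x) * ennreal \<bar>u x\<bar> \<partial>lborel)"
      by (rule nn_integral_cong_AE, use uh in eventually_elim)
        (use M in \<open>auto simp: P_def T_def indicator_def unit_ball_def ennreal_plus[symmetric] simp del: ennreal_plus\<close>)
    also have "\<dots> \<le> m * ennreal M"
      unfolding m_def M_def K_def by (rule H10_shell[OF H]) (use a in \<open>auto simp: T_def\<close>)
    finally have "m * ennreal M + (\<integral>\<^sup>+x. P (norm x) \<partial>(lborel :: (real^2) measure)) \<le> m * ennreal M + 0"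
      by (simp only: add.commute add_0)
    moreover have "m * ennreal M < top" using m by (simp add: ennreal_mult_less_top)
    ultimately have "(\<integral>\<^sup>+x. P (norm x) \<partial>(lborel :: (real^2) measure)) = 0"
      by (subst (asm) ennreal_add_left_cancel_le) auto
    then have "AE x in lborel. P (norm (x::real^2)) = 0"
      by (subst (asm) nn_integral_0_iff_AE) auto
    then show ?thesis
    proof eventually_elim
      case (elim x)
      show ?case
      proof
        assume "norm x \<in> {a..<1}"
        then have "\<bar>h (norm x)\<bar> \<le> M"
          using elim by (auto simp: P_def T_def indicator_def split: if_splits)
        then have "\<bar>h (norm x)\<bar>\<^sup>2 \<le> M\<^sup>2" by (intro power_mono) auto
        then show "(h (norm x))\<^sup>2 \<le> ln (1 / a) * K" using LK by (simp add: M_def)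
      qed
    qed
  qed
  \<comment> \<open>Only rational inner radii are used, so that the exceptional null sets are
    countably many.\<close>
  have "AE x in lborel. \<forall>a\<in>\<rat> \<inter> {0<..<1}. norm (x::real^2) \<in> {a..<1} \<longrightarrow> (h (norm x))\<^sup>2 \<le> ln (1 / a) * K"
    by (subst AE_ball_countable) (use shell in \<open>auto intro!: countable_Int1 countable_rat\<close>)
  with uh AE_lborel_singleton[of "0::real^2"] show ?thesis
  proof eventually_elim
    case (elim x)
    show ?case
    proof
      assume x: "x \<in> unit_ball"
      define s where "s = norm x"
      have s: "0 < s" "s < 1" using x elim by (auto simp: s_def unit_ball_def)
      have "(h s)\<^sup>2 \<le> ln (1 / s) * K"
      proof (rule ccontr)
        assume less: "\<not> (h s)\<^sup>2 \<le> ln (1 / s) * K"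
        \<comment> \<open>Chosen so that \<epsilon> (K + 1) is exactly the gap; K + 1 instead of K
          keeps it meaningful for K = 0 and the final inequality strict.\<close>
        define \<epsilon> where "\<epsilon> = ((h s)\<^sup>2 - ln (1 / s) * K) / (K + 1)"
        have \<epsilon>: "\<epsilon> > 0" using less K by (simp add: \<epsilon>_def)
        have "s * exp (-\<epsilon>) < s" using s \<epsilon> by simp
        then obtain a where a: "a \<in> \<rat>" "s * exp (-\<epsilon>) < a" "a < s" using Rats_dense_in_real by blast
        have a0: "a > 0" using a s by (meson exp_gt_zero less_trans mult_pos_pos)
        have "ln (s * exp (-\<epsilon>)) < ln a" using a a0 s by (subst ln_less_cancel_iff) auto
        then have l: "ln (1 / a) < ln (1 / s) + \<epsilon>" using s a0 by (simp add: ln_mult ln_div)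
        have "(h s)\<^sup>2 \<le> ln (1 / a) * K" using elim a a0 s unfolding s_def by auto
        also have "\<dots> \<le> (ln (1 / s) + \<epsilon>) * K" using l K by (intro mult_right_mono) auto
        also have "\<dots> < ln (1 / s) * K + \<epsilon> * (K + 1)" using \<epsilon> by (simp add: algebra_simps)
        also have "\<dots> = (h s)\<^sup>2" using K by (simp add: \<epsilon>_def)
        finally show False by simp
      qed
      then show "(u x)\<^sup>2 \<le> ln (1 / norm x) * (dirichlet G / (2 * pi))"
        using elim x by (simp add: s_def K_def)
    qed
  qed
qed

subsection \<open>The weight\<close>

text \<open>The inequality 1 + y <= exp y at y = c x / q, raised to the power q. It trades a
  logarithm for a small power of r, and exponential decay for a negative power.\<close>

lemma powr_le_exp:
  fixes x q c :: real
  assumes "x \<ge> 0" "q > 0" "c > 0"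
  shows "x powr q \<le> (q / c) powr q * exp (c * x)"
proof -
  have "c * x / q \<le> exp (c * x / q)" using exp_ge_add_one_self[of "c * x / q"] by linarith
  then have "(c * x / q) powr q \<le> exp (c * x / q) powr q"
    using assms by (intro powr_mono2) auto
  also have "\<dots> = exp (c * x)" using assms by (simp add: powr_def)
  finally have *: "(c * x / q) powr q \<le> exp (c * x)" .
  have "x powr q = ((q / c) * (c * x / q)) powr q" using assms by simp
  also have "\<dots> = (q / c) powr q * (c * x / q) powr q" by (rule powr_mult)
  also have "\<dots> \<le> (q / c) powr q * exp (c * x)" using * by (intro mult_left_mono) auto
  finally show ?thesis .
qed

text \<open>The special case R = 0 of the definition is absorbed, since there 1 - (1 - r) =
  r.\<close>

lemma V_weight_outer: "R \<le> r \<Longrightarrow> V_weight R \<alpha> r = (1 - (1 - r) / (1 - R)) powr \<alpha>"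
  by (auto simp: V_weight_def)

lemma V_weight_outer_le:
  assumes "0 \<le> R" "R < 1" "R \<le> r" "r < 1" "\<alpha> > 0"
  shows "V_weight R \<alpha> r \<le> r powr \<alpha>"
proof -
  have "1 - r \<le> (1 - r) / (1 - R)" using assms by (simp add: field_simps mult_left_le)
  moreover have "(1 - r) / (1 - R) \<le> 1" using assms by simp
  ultimately show ?thesis unfolding V_weight_outer[OF assms(3)]
    using assms by (intro powr_mono2) auto
qed

text \<open>From 1 - s <= exp (-s) the weight is at most exp (-y) with y = \<alpha> r / R, and
  \<open>powr_le_exp\<close> with c = 1 turns this into a power of y. The exponent k stays free to
  be tuned against \<delta>.\<close>

lemma V_weight_inner_le:
  assumes "0 < r" "r < R" "\<alpha> > 0" "k > 0"
  shows "V_weight R \<alpha> r \<le> k powr k * (R / \<alpha>) powr k * r powr (- k)"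
proof -
  define y where "y = \<alpha> * (r / R)"
  have y: "y > 0" using assms by (simp add: y_def)
  have "V_weight R \<alpha> r = (1 - r / R) powr \<alpha>" using assms by (simp add: V_weight_def)
  also have "\<dots> \<le> exp (- (r / R)) powr \<alpha>"
    using assms exp_ge_add_one_self[of "- (r / R)"] by (intro powr_mono2) auto
  also have "\<dots> = exp (- y)" by (simp add: powr_def y_def)
  also have "\<dots> \<le> k powr k * y powr (- k)"
    using powr_le_exp[of y k 1] y assms by (simp add: exp_minus powr_minus field_simps)
  also have "y powr (- k) = (R / \<alpha>) powr k * r powr (- k)"
    using assms by (simp add: y_def powr_mult powr_divide powr_minus field_simps)
  finally show ?thesis by (simp add: mult.assoc)
qed

lemma V_weight_nonneg: "V_weight R \<alpha> r \<ge> 0"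
  by (simp add: V_weight_def)

lemma V_weight_le_1:
  assumes "0 \<le> R" "R < 1" "0 \<le> r" "r < 1" "\<alpha> > 0"
  shows "V_weight R \<alpha> r \<le> 1"
proof (cases "r < R")
  case True
  then show ?thesis using assms by (auto simp: V_weight_def intro!: powr_le1)
next
  case False
  then have "V_weight R \<alpha> r \<le> r powr \<alpha>" using assms by (intro V_weight_outer_le) auto
  also have "\<dots> \<le> 1" using assms by (intro powr_le1) auto
  finally show ?thesis .
qed

text \<open>At r = R the base of the power is 0, whence the exclusion; the sphere of radius R is a
  null set.\<close>

lemma V_weight_pos:
  assumes "0 \<le> R" "R < 1" "0 \<le> r" "r < 1" "r \<noteq> R"
  shows "V_weight R \<alpha> r > 0"
proof (cases "r < R")
  case True
  then show ?thesis using assms by (auto simp: V_weight_def)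
next
  case False
  then have "(1 - r) / (1 - R) < 1" using assms by simp
  then show ?thesis using assms False V_weight_outer[of R r \<alpha>] by simp
qed

lemma V_weight_measurable [measurable]: "V_weight R \<alpha> \<in> borel_measurable borel"
proof -
  have "V_weight R \<alpha> = (\<lambda>r. if R = 0 then r powr \<alpha>
      else if r < R then (1 - r / R) powr \<alpha>
      else (1 - (1 - r) / (1 - R)) powr \<alpha>)" by (auto simp: V_weight_def fun_eq_iff)
  also have "\<dots> \<in> borel_measurable borel" by measurable
  finally show ?thesis .
qed

text \<open>Outside R, half of the exponent \<alpha> is spent on absorbing the logarithm, leaving
  r^(\<alpha> / 2). Inside, \<alpha> is already used up by the decay in R / \<alpha>, so a small
  extra power \<eta> absorbs it. Each summand covers one region and is nonnegative on the
  other.\<close>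

lemma weighted_log_le:
  assumes R: "0 \<le> R" "R < 1" and r: "0 < r" "r < 1" and p: "\<alpha> > 0" "q > 0" "k > 0" "\<eta> > 0"
  shows "V_weight R \<alpha> r * ln (1 / r) powr q \<le>
    (2 * q / \<alpha>) powr q * r powr (\<alpha> / 2) + k powr k * (q / \<eta>) powr q * (R / \<alpha>) powr k * r powr (- k - \<eta>)"
proof (cases "r < R")
  case False
  have l: "ln (1 / r) \<ge> 0" using r by (intro ln_ge_zero) auto
  have "V_weight R \<alpha> r * ln (1 / r) powr q \<le> r powr \<alpha> * ((q / (\<alpha> / 2)) powr q * exp (\<alpha> / 2 * ln (1 / r)))"
    using False assms l by (intro mult_mono V_weight_outer_le powr_le_exp) (auto simp: V_weight_nonneg)
  also have "exp (\<alpha> / 2 * ln (1 / r)) = r powr (- \<alpha> / 2)" using r by (simp add: powr_def ln_div)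
  also have "r powr \<alpha> * ((q / (\<alpha> / 2)) powr q * r powr (- \<alpha> / 2)) = (2 * q / \<alpha>) powr q * (r powr \<alpha> * r powr (- \<alpha> / 2))"
    by (simp add: mult_ac)
  also have "r powr \<alpha> * r powr (- \<alpha> / 2) = r powr (\<alpha> / 2)" by (simp add: powr_add[symmetric])
  finally show ?thesis by (simp add: add_increasing2)
next
  case True
  have l: "ln (1 / r) \<ge> 0" using r by (intro ln_ge_zero) auto
  have "V_weight R \<alpha> r * ln (1 / r) powr q \<le>
      (k powr k * (R / \<alpha>) powr k * r powr (- k)) * ((q / \<eta>) powr q * exp (\<eta> * ln (1 / r)))"
    using True assms l by (intro mult_mono V_weight_inner_le powr_le_exp) (auto simp: V_weight_nonneg)
  also have "exp (\<eta> * ln (1 / r)) = r powr (- \<eta>)" using r by (simp add: powr_def ln_div)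
  also have "(k powr k * (R / \<alpha>) powr k * r powr (- k)) * ((q / \<eta>) powr q * r powr (- \<eta>))
      = k powr k * (q / \<eta>) powr q * (R / \<alpha>) powr k * (r powr (- k) * r powr (- \<eta>))"
    by (simp add: mult_ac)
  also have "r powr (- k) * r powr (- \<eta>) = r powr (- k - \<eta>)" by (simp add: powr_add[symmetric])
  finally show ?thesis by (simp add: add_increasing)
qed

lemma nn_integral_weighted_log_le:
  assumes R: "0 \<le> R" "R < 1" and p: "\<alpha> > 0" "q > 0" "k > 0" "\<eta> > 0" "k + \<eta> < 2"
  shows "(\<integral>\<^sup>+x. indicator unit_ball x * ennreal (V_weight R \<alpha> (norm x) * ln (1 / norm x) powr q) \<partial>lborel) \<le>
    ennreal ((2 * q / \<alpha>) powr q * (4 * pi / \<alpha>)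
      + k powr k * (q / \<eta>) powr q * (R / \<alpha>) powr k * (2 * pi / (2 - k - \<eta>)))"
proof -
  define A B where "A = (2 * q / \<alpha>) powr q" and "B = k powr k * (q / \<eta>) powr q * (R / \<alpha>) powr k"
  have AB: "A \<ge> 0" "B \<ge> 0" by (auto simp: A_def B_def)
  have "(\<integral>\<^sup>+x. indicator unit_ball x * ennreal (V_weight R \<alpha> (norm x) * ln (1 / norm x) powr q) \<partial>lborel) \<le>
    (\<integral>\<^sup>+x. ennreal A * (indicator unit_ball x * ennreal (norm x powr (\<alpha> / 2)))
       + ennreal B * (indicator unit_ball x * ennreal (norm x powr (- k - \<eta>))) \<partial>lborel)"
  proof (rule nn_integral_mono_AE, use AE_lborel_singleton[of "0::real^2"] in eventually_elim)
    case (elim x)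
    show ?case
    proof (cases "x \<in> unit_ball")
      case True
      then have "V_weight R \<alpha> (norm x) * ln (1 / norm x) powr q \<le> A * norm x powr (\<alpha> / 2) + B * norm x powr (- k - \<eta>)"
        unfolding A_def B_def using elim p R by (intro weighted_log_le) (auto simp: unit_ball_def)
      then show ?thesis using True AB
        by (auto simp: ennreal_mult[symmetric] ennreal_plus[symmetric] simp del: ennreal_plus intro!: ennreal_leI)
    qed auto
  qed
  also have "\<dots> = ennreal A * ennreal (2 * pi / (\<alpha> / 2 + 2)) + ennreal B * ennreal (2 * pi / ((- k - \<eta>) + 2))"
    using p by (simp add: nn_integral_add nn_integral_cmult nn_integral_unit_ball_powr)
  also have "\<dots> = ennreal (A * (2 * pi / (\<alpha> / 2 + 2)) + B * (2 * pi / ((- k - \<eta>) + 2)))"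
  proof -
    have "ennreal A * ennreal X + ennreal B * ennreal Y = ennreal (A * X + B * Y)" if "X \<ge> 0" "Y \<ge> 0" for X Y
      using AB that by (simp add: ennreal_mult)
    then show ?thesis using p by simp
  qed
  also have "\<dots> \<le> ennreal (A * (4 * pi / \<alpha>) + B * (2 * pi / (2 - k - \<eta>)))"
  proof (intro ennreal_leI add_mono mult_left_mono AB)
    show "2 * pi / (\<alpha> / 2 + 2) \<le> 4 * pi / \<alpha>" using p by (simp add: field_simps)
  qed (simp add: algebra_simps)
  finally show ?thesis unfolding A_def B_def .
qed

text \<open>The pointwise bound makes the integrand integrable, so the Bochner integral is not a
  default 0. Strict positivity matters as well: a zero denominator would make the Rayleigh quotient
  0 and destroy the lower bound for the radial infimum.\<close>

lemma H10_radial_weighted_int: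
  assumes H: "H10 u G" and r: "radial u" and nz: "nonzero_fun u"
    and R: "0 \<le> R" "R < 1" and p: "\<alpha> > 0" "p > 1" and q: "q = (p + 1) / 2"
    and J: "(\<integral>\<^sup>+x. indicator unit_ball x * ennreal (V_weight R \<alpha> (norm x) * ln (1 / norm x) powr q) \<partial>lborel) \<le> ennreal J"
    and J0: "J \<ge> 0"
  shows "0 < weighted_int R \<alpha> p u" "weighted_int R \<alpha> p u \<le> (dirichlet G / (2 * pi)) powr q * J"
proof -
  define K where "K = dirichlet G / (2 * pi)"
  have K: "K \<ge> 0" using dirichlet_nonneg[of G] by (simp add: K_def)
  define f where "f x = indicator unit_ball x *\<^sub>R (V_weight R \<alpha> (norm x) * \<bar>u x\<bar> powr (p + 1))" for x
  have f0: "f x \<ge> 0" for x by (simp add: f_def V_weight_nonneg)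
  have W: "weighted_int R \<alpha> p u = (\<integral>x. f x \<partial>lebesgue)"
    by (simp add: weighted_int_def set_lebesgue_integral_def f_def)
  have fm: "f \<in> borel_measurable lebesgue"
  proof -
    have um: "(\<lambda>x. indicator unit_ball x *\<^sub>R u x) \<in> borel_measurable lebesgue"
      using H unfolding H10_def set_borel_measurable_def by auto
    have vm: "(\<lambda>x::real^2. V_weight R \<alpha> (norm x)) \<in> borel_measurable lebesgue"
      by (intro measurable_completion) measurable
    have "f = (\<lambda>x. V_weight R \<alpha> (norm x) * \<bar>indicator unit_ball x *\<^sub>R u x\<bar> powr (p + 1))"
      using p by (auto simp: f_def indicator_def fun_eq_iff)
    also have "\<dots> \<in> borel_measurable lebesgue" using um vm by measurable
    finally show ?thesis .
  qed
  have "(\<integral>\<^sup>+x. ennreal (f x) \<partial>lebesgue) \<le>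
      (\<integral>\<^sup>+x. ennreal (K powr q) * (indicator unit_ball x * ennreal (V_weight R \<alpha> (norm x) * ln (1 / norm x) powr q)) \<partial>lborel)"
    unfolding nn_integral_completion
  proof (rule nn_integral_mono_AE, use H10_radial_bound[OF H r] AE_lborel_singleton[of "0::real^2"] in eventually_elim)
    case (elim x)
    show ?case
    proof (cases "x \<in> unit_ball")
      case True
      then have l: "ln (1 / norm x) \<ge> 0" using elim by (intro ln_ge_zero) (auto simp: unit_ball_def)
      have "\<bar>u x\<bar> powr (p + 1) = ((u x)\<^sup>2) powr q"
      proof (cases "u x = 0")
        case False
        then have "(u x)\<^sup>2 = \<bar>u x\<bar> powr 2" by (simp add: powr_numeral)
        then have "((u x)\<^sup>2) powr q = \<bar>u x\<bar> powr (2 * q)" by (simp only: powr_powr)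
        moreover have "2 * q = p + 1" by (simp add: q)
        ultimately show ?thesis by simp
      qed (use p in \<open>auto simp: q\<close>)
      also have "\<dots> \<le> (ln (1 / norm x) * K) powr q"
        using True elim p by (intro powr_mono2) (auto simp: q K_def)
      also have "\<dots> = K powr q * ln (1 / norm x) powr q"
        using l K by (simp add: powr_mult mult.commute)
      finally have "V_weight R \<alpha> (norm x) * \<bar>u x\<bar> powr (p + 1) \<le> V_weight R \<alpha> (norm x) * (K powr q * ln (1 / norm x) powr q)"
        by (intro mult_left_mono V_weight_nonneg)
      then show ?thesis using True V_weight_nonneg[of R \<alpha> "norm x"]
        by (auto simp: f_def ennreal_mult[symmetric] mult_ac intro!: ennreal_leI)
    qed (auto simp: f_def)
  qed
  also have "\<dots> = ennreal (K powr q) * (\<integral>\<^sup>+x. indicator unit_ball x * ennreal (V_weight R \<alpha> (norm x) * ln (1 / norm x) powr q) \<partial>lborel)"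
    by (rule nn_integral_cmult) measurable
  also have "\<dots> \<le> ennreal (K powr q) * ennreal J" using J by (rule mult_left_mono) auto
  also have "\<dots> = ennreal (K powr q * J)" using J0 by (simp add: ennreal_mult)
  finally have le: "(\<integral>\<^sup>+x. ennreal (f x) \<partial>lebesgue) \<le> ennreal (K powr q * J)" .
  have fi: "integrable lebesgue f"
    by (rule integrableI_nonneg[OF fm]) (use f0 le in \<open>auto simp: less_top[symmetric] top_unique\<close>)
  have "ennreal (\<integral>x. f x \<partial>lebesgue) \<le> ennreal (K powr q * J)"
    using le f0 by (subst nn_integral_eq_integral[symmetric]) (auto intro: fi)
  then show "weighted_int R \<alpha> p u \<le> (dirichlet G / (2 * pi)) powr q * J"
    using J0 unfolding W K_def[symmetric] by (subst (asm) ennreal_le_iff) auto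
  show "0 < weighted_int R \<alpha> p u"
  proof (rule ccontr)
    assume "\<not> 0 < weighted_int R \<alpha> p u"
    moreover have "(\<integral>x. f x \<partial>lebesgue) \<ge> 0" using f0 by (intro integral_nonneg_AE) auto
    ultimately have "(\<integral>x. f x \<partial>lebesgue) = 0" unfolding W by linarith
    then have "AE x in lebesgue. f x = 0"
      using integral_nonneg_eq_0_iff_AE[OF fi] f0 by auto
    moreover have "AE x in lebesgue. x \<notin> sphere (0::real^2) R"
      by (intro AE_not_in) (simp add: negligible_iff_null_sets[symmetric] negligible_sphere)
    ultimately have "AE x in lebesgue. x \<in> unit_ball \<longrightarrow> u x = 0"
    proof eventually_elim
      case (elim x)
      then show ?case
        using V_weight_pos[OF R, of "norm x" \<alpha>] by (auto simp: f_def unit_ball_def)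
    qed
    then show False using nz unfolding nonzero_fun_def by auto
  qed
qed

text \<open>As 2 / (p + 1) = 1 / q, the power of the Dirichlet integral in the bound on the
  denominator becomes 1 and cancels against the numerator.\<close>

lemma radial_rayleigh_ge:
  assumes H: "H10 u G" and r: "radial u" and nz: "nonzero_fun u"
    and R: "0 \<le> R" "R < 1" and p: "\<alpha> > 0" "p > 1" and q: "q = (p + 1) / 2"
    and J: "(\<integral>\<^sup>+x. indicator unit_ball x * ennreal (V_weight R \<alpha> (norm x) * ln (1 / norm x) powr q) \<partial>lborel) \<le> ennreal J"
    and J0: "J > 0"
  shows "rayleigh R \<alpha> p u G \<ge> 2 * pi / J powr (1 / q)"
proof -
  define W where "W = weighted_int R \<alpha> p u"
  have W: "0 < W" "W \<le> (dirichlet G / (2 * pi)) powr q * J"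
    unfolding W_def using H10_radial_weighted_int[OF H r nz R p q J] J0 by auto
  have q0: "q > 0" using p q by simp
  have D: "dirichlet G \<ge> 0" by (rule dirichlet_nonneg)
  have "W powr (1 / q) \<le> ((dirichlet G / (2 * pi)) powr q * J) powr (1 / q)"
    using W q0 by (intro powr_mono2) auto
  also have "\<dots> = dirichlet G / (2 * pi) * J powr (1 / q)"
    using J0 q0 D by (simp add: powr_mult powr_powr)
  finally have "W powr (1 / q) \<le> dirichlet G / (2 * pi) * J powr (1 / q)" .
  moreover have "W powr (1 / q) > 0" "J powr (1 / q) > 0" using W J0 by auto
  ultimately have "2 * pi / J powr (1 / q) \<le> dirichlet G / W powr (1 / q)"
    by (simp add: field_simps)
  moreover have "1 / q = 2 / (p + 1)" by (simp add: q)
  ultimately show ?thesis unfolding rayleigh_def W_def by simp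
qed

subsection \<open>Bump functions near the boundary\<close>

text \<open>The linearisation error is at most h^2 for every combination of signs of t and t + h,
  also across the kink.\<close>

lemma has_field_derivative_max0_square:
  "((\<lambda>t::real. (max 0 t)\<^sup>2) has_field_derivative 2 * max 0 t) (at t)"
proof -
  have bound: "\<bar>(max 0 (t + h))\<^sup>2 - (max 0 t)\<^sup>2 - 2 * max 0 t * h\<bar> \<le> h\<^sup>2" for h :: real
  proof -
    consider "t \<ge> 0" "t + h \<ge> 0" | "t \<ge> 0" "t + h < 0" | "t < 0" "t + h \<ge> 0" | "t < 0" "t + h < 0"
      by linarith
    then show ?thesis
    proof cases
      case 1
      then show ?thesis by (simp add: power2_eq_square algebra_simps)
    next
      case 2
      have "t * (t + h) \<le> 0" "0 \<le> (t + h)\<^sup>2" "0 \<le> t\<^sup>2" using 2 by (auto simp: mult_nonneg_nonpos)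
      moreover have "t * (t + 2 * h) \<le> 0" using 2 by (intro mult_nonneg_nonpos) auto
      ultimately show ?thesis using 2 by (simp add: power2_eq_square algebra_simps)
    next
      case 3
      then have "(t + h)\<^sup>2 \<le> h\<^sup>2" by (intro power_mono) auto
      then show ?thesis using 3 by simp
    qed simp
  qed
  have "(\<lambda>h. ((max 0 (t + h))\<^sup>2 - (max 0 t)\<^sup>2) / h) \<midarrow>0\<rightarrow> 2 * max 0 t"
  proof (rule LIM_zero_cancel, rule Lim_null_comparison)
    show "\<forall>\<^sub>F h in at 0. norm (((max 0 (t + h))\<^sup>2 - (max 0 t)\<^sup>2) / h - 2 * max 0 t) \<le> \<bar>h\<bar>"
      unfolding eventually_at_filter
    proof (intro always_eventually allI impI)
      fix h :: real assume h: "h \<noteq> 0"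
      have "((max 0 (t + h))\<^sup>2 - (max 0 t)\<^sup>2) / h - 2 * max 0 t
          = ((max 0 (t + h))\<^sup>2 - (max 0 t)\<^sup>2 - 2 * max 0 t * h) / h"
        using h by (simp add: field_simps)
      also have "norm \<dots> \<le> h\<^sup>2 / \<bar>h\<bar>"
        using bound[of h] by (simp add: divide_right_mono)
      also have "\<dots> = \<bar>h\<bar>" using h by (simp add: power2_eq_square abs_if)
      finally show "norm (((max 0 (t + h))\<^sup>2 - (max 0 t)\<^sup>2) / h - 2 * max 0 t) \<le> \<bar>h\<bar>" .
    qed
    show "((\<lambda>h::real. \<bar>h\<bar>) \<longlongrightarrow> 0) (at 0)"
      using tendsto_rabs[OF tendsto_ident_at[of "0::real" UNIV]] by simp
  qed
  then show ?thesis by (simp add: DERIV_def)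
qed

text \<open>Squaring the positive part of a smooth function gives the C^1 regularity asked by
  \<open>test_fun\<close>, with support in a closed disc and an elementary gradient.\<close>

definition bump :: "real^2 \<Rightarrow> real \<Rightarrow> real^2 \<Rightarrow> real" where
  "bump z \<rho> x = (max 0 (1 - (norm (x - z) / \<rho>)\<^sup>2))\<^sup>2"

definition bump_grad :: "real^2 \<Rightarrow> real \<Rightarrow> real^2 \<Rightarrow> real^2" where
  "bump_grad z \<rho> x = (- 4 / \<rho>\<^sup>2 * max 0 (1 - (norm (x - z) / \<rho>)\<^sup>2)) *\<^sub>R (x - z)"

lemma test_fun_bump:
  assumes "\<rho> > 0" "norm z + \<rho> < 1"
  shows "test_fun (bump z \<rho>) (bump_grad z \<rho>)"
  unfolding test_fun_def
proof (intro conjI allI)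
  show "continuous_on UNIV (bump_grad z \<rho>)"
    unfolding bump_grad_def using assms by (intro continuous_intros) auto
  fix x
  have "((\<lambda>x. 1 - (norm (x - z) / \<rho>)\<^sup>2) has_derivative (\<lambda>h. - (2 / \<rho>\<^sup>2) * ((x - z) \<bullet> h))) (at x)"
  proof -
    have "((\<lambda>x. 1 - c * ((x - z) \<bullet> (x - z))) has_derivative (\<lambda>h. - (2 * c) * ((x - z) \<bullet> h))) (at x)" for c
      by (auto intro!: derivative_eq_intros simp: inner_commute algebra_simps)
    from this[of "1 / \<rho>\<^sup>2"] show ?thesis by (simp add: power_divide power2_norm_eq_inner)
  qed
  then have "(bump z \<rho> has_derivative (\<lambda>h. 2 * max 0 (1 - (norm (x - z) / \<rho>)\<^sup>2) * (- (2 / \<rho>\<^sup>2) * ((x - z) \<bullet> h)))) (at x)"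
    unfolding bump_def
    by (rule has_derivative_compose[OF _ has_field_derivative_max0_square[unfolded has_field_derivative_def]])
  then show "(bump z \<rho> has_derivative (\<lambda>h. bump_grad z \<rho> x \<bullet> h)) (at x)"
    by (simp add: bump_grad_def mult_ac)
next
  have "{x. bump z \<rho> x \<noteq> 0} \<subseteq> cball z \<rho>"
  proof
    fix x assume "x \<in> {x. bump z \<rho> x \<noteq> 0}"
    then have "(norm (x - z) / \<rho>)\<^sup>2 < 1" by (auto simp: bump_def max_def split: if_splits)
    then have "norm (x - z) / \<rho> < 1" using assms by (simp add: power_less_one_iff abs_square_less_1)
    then show "x \<in> cball z \<rho>" using assms by (simp add: dist_norm norm_minus_commute)
  qed
  then have "closure {x. bump z \<rho> x \<noteq> 0} \<subseteq> cball z \<rho>" by (rule closure_minimal) simp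
  also have "\<dots> \<subseteq> unit_ball"
  proof
    fix x assume "x \<in> cball z \<rho>"
    then have "norm (x - z) \<le> \<rho>" by (simp add: dist_norm norm_minus_commute)
    then have "norm x \<le> norm z + \<rho>" using norm_triangle_sub[of x z] by linarith
    then show "x \<in> unit_ball" using assms by (simp add: unit_ball_def)
  qed
  finally show "closure {x. bump z \<rho> x \<noteq> 0} \<subseteq> unit_ball" .
qed

lemma H10_test_fun:
  assumes t: "test_fun \<phi> g"
  shows "H10 \<phi> g"
proof -
  \<comment> \<open>Subtracting the zero function lets the lemma on differences supply measurability
    and square integrability of \<phi> and g themselves; the approximating sequence is
    constant.\<close>
  have z: "set_borel_measurable lebesgue unit_ball (\<lambda>x. 0 :: 'b::euclidean_space)"
    "set_integrable lebesgue unit_ball (\<lambda>x. (norm (0 :: 'b))\<^sup>2)"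
    by (auto simp: set_borel_measurable_def set_integrable_def)
  show ?thesis unfolding H10_def
    using diff_square_integrable_unit_ball[OF test_fun_continuous(1)[OF t] z]
      diff_square_integrable_unit_ball[OF test_fun_continuous(2)[OF t] z]
    by (auto intro!: exI[of _ "\<lambda>_. \<phi>"] exI[of _ "\<lambda>_. g"] t)
qed

lemma ball_subset_unit_ball:
  assumes "norm z + \<rho> < 1"
  shows "ball z \<rho> \<subseteq> unit_ball"
proof
  fix x assume "x \<in> ball z \<rho>"
  then have "norm (x - z) < \<rho>" by (simp add: dist_norm norm_minus_commute)
  then have "norm x < norm z + \<rho>" using norm_triangle_sub[of x z] by linarith
  then show "x \<in> unit_ball" using assms by (simp add: unit_ball_def)
qed

lemma nonzero_fun_bump:
  assumes "\<rho> > 0" "norm z + \<rho> < 1"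
  shows "nonzero_fun (bump z \<rho>)"
  unfolding nonzero_fun_def
proof
  assume "AE x in lebesgue. x \<in> unit_ball \<longrightarrow> bump z \<rho> x = 0"
  then have "AE x in lborel. x \<notin> ball z \<rho>"
    unfolding AE_completion_iff
  proof eventually_elim
    case (elim x)
    show ?case
    proof
      assume x: "x \<in> ball z \<rho>"
      then have "norm (x - z) / \<rho> < 1" using assms by (simp add: dist_norm norm_minus_commute)
      then have "(norm (x - z) / \<rho>)\<^sup>2 < 1" using assms by (simp add: abs_square_less_1)
      then have "bump z \<rho> x \<noteq> 0" by (simp add: bump_def)
      then show False using elim x ball_subset_unit_ball[OF assms(2)] by auto
    qed
  qed
  then have "emeasure lborel (ball z \<rho>) = 0"
    by (subst (asm) AE_iff_measurable[of "ball z \<rho>"]) auto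
  then show False using assms by (simp add: emeasure_ball unit_ball_vol_2)
qed

text \<open>The gradient is at most 4 / \<rho> on a disc of area pi \<rho>^2, so \<rho> cancels: the
  scale invariance of the planar Dirichlet integral.\<close>

lemma dirichlet_bump_le:
  assumes "\<rho> > 0" "norm z + \<rho> < 1"
  shows "dirichlet (bump_grad z \<rho>) \<le> 16 * pi"
proof -
  have "H10 (bump z \<rho>) (bump_grad z \<rho>)" using assms by (intro H10_test_fun test_fun_bump)
  then have i: "integrable lebesgue (\<lambda>x. indicator unit_ball x *\<^sub>R (norm (bump_grad z \<rho> x))\<^sup>2)"
    unfolding H10_def set_integrable_def by auto
  have "dirichlet (bump_grad z \<rho>) \<le> (\<integral>x. 16 / \<rho>\<^sup>2 * indicator (ball z \<rho>) x \<partial>lebesgue)"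
    unfolding dirichlet_def set_lebesgue_integral_def
  proof (rule integral_mono[OF i])
    show "integrable lebesgue (\<lambda>x. 16 / \<rho>\<^sup>2 * indicator (ball z \<rho>) x)"
      by (intro integrable_mult_right integrable_real_indicator) (use emeasure_lborel_ball_finite in auto)
    fix x
    show "indicator unit_ball x *\<^sub>R (norm (bump_grad z \<rho> x))\<^sup>2 \<le> 16 / \<rho>\<^sup>2 * indicator (ball z \<rho>) x"
    proof (cases "x \<in> ball z \<rho>")
      case True
      then have n: "norm (x - z) \<le> \<rho>" by (simp add: dist_norm norm_minus_commute)
      have "norm (bump_grad z \<rho> x) = 4 / \<rho>\<^sup>2 * max 0 (1 - (norm (x - z) / \<rho>)\<^sup>2) * norm (x - z)"
        by (simp add: bump_grad_def abs_mult)
      also have "\<dots> \<le> 4 / \<rho>\<^sup>2 * 1 * \<rho>" using n assms by (intro mult_mono) auto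
      also have "\<dots> = 4 / \<rho>" using assms by (simp add: power2_eq_square)
      finally have "(norm (bump_grad z \<rho> x))\<^sup>2 \<le> (4 / \<rho>)\<^sup>2" by (intro power_mono) auto
      then show ?thesis using True by (simp add: power_divide indicator_def)
    next
      case False
      then have "norm (x - z) / \<rho> \<ge> 1" using assms by (simp add: dist_norm norm_minus_commute)
      then have "(norm (x - z) / \<rho>)\<^sup>2 \<ge> 1" by simp
      then have "bump_grad z \<rho> x = 0" by (simp add: bump_grad_def)
      then show ?thesis by simp
    qed
  qed
  also have "\<dots> = 16 / \<rho>\<^sup>2 * measure lborel (ball z \<rho>)" by (simp add: measure_completion)
  also have "\<dots> = 16 * pi" using assms by (simp add: content_ball unit_ball_vol_2)
  finally show ?thesis .
qed

text \<open>On the concentric disc of half the radius, of area pi \<rho>^2 / 4, the bump is at least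
  (1 - 1/4)^2 = 9/16.\<close>

lemma weighted_int_bump_ge:
  assumes \<rho>: "\<rho> > 0" "norm z + \<rho> < 1" and R: "0 \<le> R" "R < 1" and p: "\<alpha> > 0" "p > 1"
    and v: "\<And>x. x \<in> ball z \<rho> \<Longrightarrow> V_weight R \<alpha> (norm x) \<ge> v" "v \<ge> 0"
  shows "weighted_int R \<alpha> p (bump z \<rho>) \<ge> v * (9 / 16) powr (p + 1) * (pi / 4) * \<rho>\<^sup>2"
proof -
  have t: "test_fun (bump z \<rho>) (bump_grad z \<rho>)" using \<rho> by (rule test_fun_bump)
  note [measurable] = test_fun_measurable[OF t]
  define f where "f x = indicator unit_ball x *\<^sub>R (V_weight R \<alpha> (norm x) * \<bar>bump z \<rho> x\<bar> powr (p + 1))" for x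
  have f0: "f x \<ge> 0" for x by (simp add: f_def V_weight_nonneg)
  have fm: "f \<in> borel_measurable borel" unfolding f_def by measurable
  have b1: "0 \<le> bump z \<rho> x \<and> bump z \<rho> x \<le> 1" for x
    unfolding bump_def by (auto intro!: power_le_one)
  \<comment> \<open>Without integrability the Bochner integral would be 0 by default and no lower
    bound could hold.\<close>
  have fi: "integrable lebesgue f"
  proof (rule Bochner_Integration.integrable_bound)
    show "integrable lebesgue (indicator unit_ball :: real^2 \<Rightarrow> real)"
      by (auto simp: unit_ball_def emeasure_ball)
    show "f \<in> borel_measurable lebesgue" using fm by (simp add: measurable_completion)
    show "AE x in lebesgue. norm (f x) \<le> norm (indicator unit_ball x :: real)"
    proof (intro always_eventually allI)
      fix x
      have "V_weight R \<alpha> (norm x) * \<bar>bump z \<rho> x\<bar> powr (p + 1) \<le> 1 * 1" if "x \<in> unit_ball"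
        using that b1[of x] p R
        by (intro mult_mono V_weight_le_1 powr_le1) (auto simp: unit_ball_def)
      then show "norm (f x) \<le> norm (indicator unit_ball x :: real)"
        by (auto simp: f_def indicator_def V_weight_nonneg)
    qed
  qed
  define w where "w = v * (9 / 16) powr (p + 1)"
  have "w * measure lborel (ball z (\<rho> / 2)) = (\<integral>x. w * indicator (ball z (\<rho> / 2)) x \<partial>lebesgue)"
    by (simp add: measure_completion)
  also have "\<dots> \<le> (\<integral>x. f x \<partial>lebesgue)"
  proof (rule integral_mono[OF _ fi])
    show "integrable lebesgue (\<lambda>x. w * indicator (ball z (\<rho> / 2)) x)"
      by (intro integrable_mult_right integrable_real_indicator) (use emeasure_lborel_ball_finite in auto)
    fix x
    show "w * indicator (ball z (\<rho> / 2)) x \<le> f x"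
    proof (cases "x \<in> ball z (\<rho> / 2)")
      case True
      then have x: "x \<in> ball z \<rho>" using \<rho> by auto
      have "norm (x - z) / \<rho> \<le> 1 / 2" using True \<rho> by (simp add: dist_norm norm_minus_commute)
      then have "(norm (x - z) / \<rho>)\<^sup>2 \<le> (1 / 2)\<^sup>2" using \<rho> by (intro power_mono) auto
      moreover have "(1 / 2 :: real)\<^sup>2 = 1 / 4" by (simp add: power2_eq_square)
      ultimately have "3 / 4 \<le> max 0 (1 - (norm (x - z) / \<rho>)\<^sup>2)" by linarith
      then have "(3 / 4)\<^sup>2 \<le> bump z \<rho> x" unfolding bump_def by (rule power_mono) simp
      then have "9 / 16 \<le> \<bar>bump z \<rho> x\<bar>" by (simp add: power2_eq_square)
      then have "v * (9 / 16) powr (p + 1) \<le> V_weight R \<alpha> (norm x) * \<bar>bump z \<rho> x\<bar> powr (p + 1)"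
        using v x p V_weight_nonneg by (intro mult_mono powr_mono2) auto
      moreover have "x \<in> unit_ball" using x ball_subset_unit_ball[OF \<rho>(2)] by auto
      ultimately show ?thesis using True by (simp add: f_def w_def)
    qed (use f0 in auto)
  qed
  also have "\<dots> = weighted_int R \<alpha> p (bump z \<rho>)"
    by (simp add: weighted_int_def set_lebesgue_integral_def f_def)
  also have "measure lborel (ball z (\<rho> / 2)) = (pi / 4) * \<rho>\<^sup>2"
    using \<rho> by (simp add: content_ball unit_ball_vol_2 power_divide)
  finally show ?thesis by (simp add: w_def mult.assoc)
qed

text \<open>As 1 - R >= 1/2, the base of the power is at least 1 - t with t = 6 / \<alpha>. For t <=
  1/2, that is \<alpha> >= 12, one has ln (1 - t) >= -2 t, so the exponent is at least -2 \<alpha> t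
  = -12.\<close>

lemma V_weight_boundary_ge:
  assumes "0 \<le> R" "R \<le> 1 / 2" "\<alpha> \<ge> 12" "1 - 3 / \<alpha> \<le> r" "r < 1"
  shows "V_weight R \<alpha> r \<ge> exp (- 12)"
proof -
  have a: "3 / \<alpha> \<le> 1 / 4" using assms by (simp add: field_simps)
  then have "R \<le> r" using assms by linarith
  define t where "t = 6 / \<alpha>"
  have t: "0 \<le> t" "t \<le> 1 / 2" using assms by (auto simp: t_def field_simps)
  have "(1 - r) / (1 - R) \<le> (3 / \<alpha>) / (1 / 2)" using assms by (intro frac_le) auto
  then have le: "1 - t \<le> 1 - (1 - r) / (1 - R)" by (simp add: t_def)
  have "t * t \<le> t * (1 / 2)" using t by (intro mult_left_mono) auto
  then have "- (2 * t) \<le> - t - 2 * t\<^sup>2" by (simp add: power2_eq_square)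
  also have "\<dots> \<le> ln (1 - t)" using t by (intro ln_one_minus_pos_lower_bound) auto
  finally have "\<alpha> * - (2 * t) \<le> \<alpha> * ln (1 - t)" using assms by (intro mult_left_mono) auto
  then have "exp (- 12) \<le> (1 - t) powr \<alpha>" using assms t by (simp add: powr_def t_def)
  also have "\<dots> \<le> (1 - (1 - r) / (1 - R)) powr \<alpha>" using le t assms by (intro powr_mono2) auto
  finally show ?thesis using V_weight_outer[OF \<open>R \<le> r\<close>] by simp
qed

subsection \<open>Comparison of the two infima\<close>

lemma rayleigh_nonneg: "rayleigh R \<alpha> p u G \<ge> 0"
  by (simp add: rayleigh_def dirichlet_nonneg)

lemma S_alpha_le:
  assumes "H10 u G" "nonzero_fun u"
  shows "S_alpha R \<alpha> p \<le> rayleigh R \<alpha> p u G"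
  unfolding S_alpha_def
  by (rule cInf_lower) (use assms rayleigh_nonneg in \<open>auto intro!: bdd_belowI[of _ 0]\<close>)

lemma S_alpha_rad_le:
  assumes "H10 u G" "nonzero_fun u" "radial u"
  shows "S_alpha_rad R \<alpha> p \<le> rayleigh R \<alpha> p u G"
  unfolding S_alpha_rad_def
  by (rule cInf_lower) (use assms rayleigh_nonneg in \<open>auto intro!: bdd_belowI[of _ 0]\<close>)

lemma S_alpha_upper:
  assumes R: "0 \<le> R" "R \<le> 1 / 2" and p: "p > 1" "\<alpha> \<ge> 12"
  shows "S_alpha R \<alpha> p \<le> 16 * pi / (exp (- 12) * (9 / 16) powr (p + 1) * (pi / 4) / \<alpha>\<^sup>2) powr (2 / (p + 1))"
proof -
  obtain e :: "real^2" where e: "norm e = 1" using vector_choose_size[of 1] by auto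
  \<comment> \<open>The disc of radius 1 / \<alpha> centred at distance 2 / \<alpha> from the
    boundary lies in the annulus 1 - 3 / \<alpha> < |x| < 1 - 1 / \<alpha>, where
    \<open>V_weight_boundary_ge\<close> applies.\<close>
  define \<rho> where "\<rho> = 1 / \<alpha>"
  define z where "z = (1 - 2 / \<alpha>) *\<^sub>R e"
  have a: "2 / \<alpha> \<le> 1" using p by simp
  have nz: "norm z = 1 - 2 / \<alpha>" using e a by (simp add: z_def)
  have \<rho>: "\<rho> > 0" "norm z + \<rho> < 1" using p nz by (auto simp: \<rho>_def)
  have V: "V_weight R \<alpha> (norm x) \<ge> exp (- 12)" if x: "x \<in> ball z \<rho>" for x
  proof (rule V_weight_boundary_ge[OF R p(2)])
    show "norm x < 1" using x ball_subset_unit_ball[OF \<rho>(2)] by (auto simp: unit_ball_def)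
    have "norm z - norm x \<le> norm (z - x)" by (rule norm_triangle_ineq2)
    also have "\<dots> < 1 / \<alpha>" using x by (simp add: dist_norm \<rho>_def)
    finally show "1 - 3 / \<alpha> \<le> norm x" using nz by (simp add: field_simps)
  qed
  define w where "w = exp (- 12) * (9 / 16) powr (p + 1) * (pi / 4) / \<alpha>\<^sup>2"
  have w: "w > 0" using p by (simp add: w_def)
  have "w \<le> weighted_int R \<alpha> p (bump z \<rho>)"
    using weighted_int_bump_ge[OF \<rho>, of R \<alpha> p "exp (- 12)"] V R p
    by (simp add: w_def \<rho>_def power_divide)
  then have "w powr (2 / (p + 1)) \<le> weighted_int R \<alpha> p (bump z \<rho>) powr (2 / (p + 1))"
    using w p by (intro powr_mono2) auto
  moreover have "w powr (2 / (p + 1)) > 0" using w by simp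
  ultimately have "rayleigh R \<alpha> p (bump z \<rho>) (bump_grad z \<rho>) \<le> 16 * pi / w powr (2 / (p + 1))"
    unfolding rayleigh_def using dirichlet_bump_le[OF \<rho>] dirichlet_nonneg
    by (intro frac_le) auto
  then show ?thesis
    using S_alpha_le[OF H10_test_fun[OF test_fun_bump[OF \<rho>]] nonzero_fun_bump[OF \<rho>], of R \<alpha> p]
    unfolding w_def by linarith
qed

lemma S_alpha_rad_lower:
  assumes R: "0 \<le> R" "R < 1" and p: "\<alpha> > 0" "p > 1" and q: "q = (p + 1) / 2"
    and J: "(\<integral>\<^sup>+x. indicator unit_ball x * ennreal (V_weight R \<alpha> (norm x) * ln (1 / norm x) powr q) \<partial>lborel) \<le> ennreal J"
    and J0: "J > 0"
  shows "S_alpha_rad R \<alpha> p \<ge> 2 * pi / J powr (1 / q)"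
  unfolding S_alpha_rad_def
proof (rule cInf_greatest)
  \<comment> \<open>A lower bound for a real infimum needs a nonempty set; the bump centred at the
    origin is a radial competitor.\<close>
  have \<rho>: "(1 / 2 :: real) > 0" "norm (0::real^2) + 1 / 2 < 1" by auto
  have "radial (bump 0 (1 / 2))"
    unfolding radial_def
    by (rule exI[of _ "\<lambda>s. (max 0 (1 - (s / (1 / 2))\<^sup>2))\<^sup>2"]) (simp add: bump_def)
  then show "{rayleigh R \<alpha> p u G |u G. H10 u G \<and> nonzero_fun u \<and> radial u} \<noteq> {}"
    using H10_test_fun[OF test_fun_bump[OF \<rho>]] nonzero_fun_bump[OF \<rho>] by blast
qed (use radial_rayleigh_ge[OF _ _ _ R p q J J0] in auto)

text \<open>A radial groundstate would give a radial minimiser u and put the radial infimum at or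
  below \<open>S_alpha\<close>. Passing from w back to u divides by a power of
  \<open>S_alpha\<close>, so \<open>S_alpha\<close> must be shown positive: at 0 the function w
  would vanish identically and be trivially radial.\<close>

lemma groundstate_not_radial:
  assumes S: "S_alpha R \<alpha> p < S_alpha_rad R \<alpha> p" and w: "groundstate R \<alpha> p w"
  shows "\<not> radial w"
proof
  assume "radial w"
  then obtain f where f: "AE x in lebesgue. x \<in> unit_ball \<longrightarrow> w x = f (norm x)"
    unfolding radial_def by auto
  from w obtain u G where H: "H10 u G" and pos: "AE x in lebesgue. x \<in> unit_ball \<longrightarrow> u x > 0"
    and W: "weighted_int R \<alpha> p u = 1" and ray: "rayleigh R \<alpha> p u G = S_alpha R \<alpha> p"
    and w_eq: "w = (\<lambda>x. S_alpha R \<alpha> p powr (1 / (p - 1)) * u x)"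
    unfolding groundstate_def by auto
  have nz: "nonzero_fun u"
    unfolding nonzero_fun_def
  proof
    assume "AE x in lebesgue. x \<in> unit_ball \<longrightarrow> u x = 0"
    with pos have "AE x in lebesgue. x \<notin> unit_ball" by eventually_elim auto
    then have "emeasure lborel unit_ball = 0"
      unfolding AE_completion_iff by (subst (asm) AE_iff_measurable[of unit_ball]) auto
    then show False by (simp add: unit_ball_def emeasure_ball unit_ball_vol_2)
  qed
  have "dirichlet G \<noteq> 0"
    using H10_dirichlet_zero[OF H] nz unfolding nonzero_fun_def by auto
  then have S0: "S_alpha R \<alpha> p > 0"
    using ray W dirichlet_nonneg[of G] by (simp add: rayleigh_def)
  then have "S_alpha R \<alpha> p powr (1 / (p - 1)) > 0" by simp
  then have "radial u"
    unfolding radial_def using f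
    by (intro exI[of _ "\<lambda>s. f s / S_alpha R \<alpha> p powr (1 / (p - 1))"]) (auto simp: w_eq field_simps elim!: eventually_mono)
  then show False using S_alpha_rad_le[OF H nz, of R \<alpha> p] ray S by simp
qed

text \<open>The factor 8 is 16 pi / (2 pi), the ratio of the constants in the two bounds, raised to
  the power q because \<open>less\<close> compares q-th powers.\<close>

lemma S_alpha_less_rad:
  assumes R: "0 \<le> R" "R \<le> 1 / 2" and p: "p > 1" "\<alpha> \<ge> 12" and q: "q = (p + 1) / 2"
    and J: "(\<integral>\<^sup>+x. indicator unit_ball x * ennreal (V_weight R \<alpha> (norm x) * ln (1 / norm x) powr q) \<partial>lborel) \<le> ennreal J"
    and J0: "J > 0" and less: "8 powr q * (\<alpha>\<^sup>2 * J) < exp (- 12) * (9 / 16) powr (p + 1) * (pi / 4)"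
  shows "S_alpha R \<alpha> p < S_alpha_rad R \<alpha> p"
proof -
  define w where "w = exp (- 12) * (9 / 16) powr (p + 1) * (pi / 4) / \<alpha>\<^sup>2"
  have q0: "q > 0" "2 / (p + 1) = 1 / q" using p by (auto simp: q)
  have w: "w > 0" using p by (simp add: w_def)
  have "8 powr q * J < w" using less p by (simp add: w_def field_simps)
  then have "(8 powr q * J) powr (1 / q) < w powr (1 / q)"
    using J0 q0 by (intro powr_less_mono2) auto
  then have "8 * J powr (1 / q) < w powr (1 / q)"
    using J0 q0 by (simp add: powr_mult powr_powr)
  then have "16 * pi / w powr (1 / q) < 2 * pi / J powr (1 / q)"
    using J0 w by (simp add: field_simps)
  moreover have "S_alpha R \<alpha> p \<le> 16 * pi / w powr (1 / q)"
    using S_alpha_upper[OF R p] unfolding w_def q0 .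
  moreover have "2 * pi / J powr (1 / q) \<le> S_alpha_rad R \<alpha> p"
    using R p by (intro S_alpha_rad_lower[OF _ _ _ _ q J J0]) auto
  ultimately show ?thesis by linarith
qed

text \<open>After multiplication by \<alpha>^2 the outer term is of order \<alpha>^(2 - q - 1) and
  the inner one of order \<alpha>^(2 - k (1 + \<delta>)); the hypotheses make both exponents
  negative.\<close>

lemma weighted_log_bound_tendsto:
  fixes q k \<eta> \<delta> C :: real
  assumes "q > 1" "k * (1 + \<delta>) > 2" "k > 0" "C > 0"
  shows "((\<lambda>\<alpha>. \<alpha>\<^sup>2 * ((2 * q / \<alpha>) powr q * (4 * pi / \<alpha>)
      + k powr k * (q / \<eta>) powr q * (C * \<alpha> powr (- \<delta>) / \<alpha>) powr k * (2 * pi / (2 - k - \<eta>)))) \<longlongrightarrow> 0) at_top"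
proof -
  define A B where "A = (2 * q) powr q * (4 * pi)" and "B = k powr k * (q / \<eta>) powr q * (C powr k) * (2 * pi / (2 - k - \<eta>))"
  have "((\<lambda>\<alpha>::real. A * \<alpha> powr (- (q - 1)) + B * \<alpha> powr (- (k * (1 + \<delta>) - 2)))
      \<longlongrightarrow> A * 0 + B * 0) at_top"
    by (intro tendsto_intros tendsto_neg_powr filterlim_ident) (use assms in auto)
  then have lim: "((\<lambda>\<alpha>::real. A * \<alpha> powr (- (q - 1)) + B * \<alpha> powr (- (k * (1 + \<delta>) - 2)))
      \<longlongrightarrow> 0) at_top" by simp
  show ?thesis
  proof (rule Lim_transform_eventually[OF lim])
    show "\<forall>\<^sub>F \<alpha> in at_top. A * \<alpha> powr (- (q - 1)) + B * \<alpha> powr (- (k * (1 + \<delta>) - 2)) =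
      \<alpha>\<^sup>2 * ((2 * q / \<alpha>) powr q * (4 * pi / \<alpha>)
      + k powr k * (q / \<eta>) powr q * (C * \<alpha> powr (- \<delta>) / \<alpha>) powr k * (2 * pi / (2 - k - \<eta>)))"
      using eventually_gt_at_top[of 0]
    proof eventually_elim
      case (elim \<alpha>)
      have sq: "\<alpha>\<^sup>2 = \<alpha> powr 2" using elim by (simp add: powr_numeral)
      have "\<alpha>\<^sup>2 * (2 * q / \<alpha>) powr q = (2 * q) powr q * (\<alpha> powr 2 * \<alpha> powr (- q))"
        unfolding sq using elim assms by (simp add: powr_divide powr_minus field_simps)
      also have "\<alpha> powr 2 * \<alpha> powr (- q) = \<alpha> powr (- (q - 1) + 1)"
        by (subst powr_add[symmetric]) simp
      also have "\<dots> = \<alpha> powr (- (q - 1)) * \<alpha>"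
        using elim by (subst powr_add) simp
      finally have 1: "\<alpha>\<^sup>2 * (2 * q / \<alpha>) powr q = (2 * q) powr q * (\<alpha> powr (- (q - 1)) * \<alpha>)" .
      have "C * \<alpha> powr (- \<delta>) / \<alpha> = C * \<alpha> powr (- \<delta> - 1)"
        using elim by (simp add: powr_diff)
      then have "\<alpha>\<^sup>2 * (C * \<alpha> powr (- \<delta>) / \<alpha>) powr k = C powr k * (\<alpha> powr 2 * \<alpha> powr ((- \<delta> - 1) * k))"
        unfolding sq using assms by (simp add: powr_mult powr_powr)
      also have "\<alpha> powr 2 * \<alpha> powr ((- \<delta> - 1) * k) = \<alpha> powr (- (k * (1 + \<delta>) - 2))"
        by (subst powr_add[symmetric]) (simp add: algebra_simps)
      finally have 2: "\<alpha>\<^sup>2 * (C * \<alpha> powr (- \<delta>) / \<alpha>) powr k = C powr k * \<alpha> powr (- (k * (1 + \<delta>) - 2))" .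
      have "\<alpha>\<^sup>2 * ((2 * q / \<alpha>) powr q * (4 * pi / \<alpha>)
        + k powr k * (q / \<eta>) powr q * (C * \<alpha> powr (- \<delta>) / \<alpha>) powr k * (2 * pi / (2 - k - \<eta>)))
        = (\<alpha>\<^sup>2 * (2 * q / \<alpha>) powr q) * (4 * pi / \<alpha>)
        + k powr k * (q / \<eta>) powr q * (\<alpha>\<^sup>2 * (C * \<alpha> powr (- \<delta>) / \<alpha>) powr k) * (2 * pi / (2 - k - \<eta>))"
        by (simp add: distrib_left mult_ac)
      then show ?case unfolding 1 2 A_def B_def using elim by (simp add: mult_ac)
    qed
  qed
qed

theorem mainTheorem3:
  fixes p \<delta> :: real and R :: "real \<Rightarrow> real"
  assumes "p > 1" and "\<delta> > 0"
    and "eventually (\<lambda>a. 0 \<le> R a \<and> R a < 1) at_top"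
    and "Limsup at_top (\<lambda>a. ereal (a powr \<delta> * R a)) < \<infinity>"
  shows "\<exists>a0>0. \<forall>\<alpha>>a0. S_alpha (R \<alpha>) \<alpha> p < S_alpha_rad (R \<alpha>) \<alpha> p \<and>
            (\<forall>w. groundstate (R \<alpha>) \<alpha> p w \<longrightarrow> \<not> radial w)"
proof -
  define q where "q = (p + 1) / 2"
  \<comment> \<open>Any k strictly between 2 / (1 + \<delta>) and 2 works: the lower limit beats
    \<alpha>^2, the upper one keeps the singularity at the origin integrable. \<open>\<eta>\<close>
    is half of the remaining room 2 - k.\<close>
  define k where "k = 2 / (1 + \<delta> / 2)"
  define \<eta> where "\<eta> = (2 - k) / 2"
  have q: "q > 1" using assms(1) by (simp add: q_def)
  have k: "0 < k" "k < 2" "k * (1 + \<delta>) > 2" using assms(2) by (auto simp: k_def field_simps)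
  have \<eta>: "\<eta> > 0" "k + \<eta> < 2" using k by (auto simp: \<eta>_def field_simps)
  obtain C0 :: real where "Limsup at_top (\<lambda>a. ereal (a powr \<delta> * R a)) < ereal C0"
    using assms(4) less_PInf_Ex_of_nat by (metis ereal_dense2 ereal_infty_less(1) less_ereal.simps(4))
  then have ev1: "\<forall>\<^sub>F a in at_top. a powr \<delta> * R a < C0"
    using Limsup_lessD by fastforce
  define C where "C = max 1 C0"
  have C: "C > 0" "C0 \<le> C" by (auto simp: C_def)
  define J where "J \<alpha> = (2 * q / \<alpha>) powr q * (4 * pi / \<alpha>)
      + k powr k * (q / \<eta>) powr q * (C * \<alpha> powr (- \<delta>) / \<alpha>) powr k * (2 * pi / (2 - k - \<eta>))" for \<alpha>
  have "((\<lambda>\<alpha>. 8 powr q * (\<alpha>\<^sup>2 * J \<alpha>)) \<longlongrightarrow> 8 powr q * 0) at_top"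
    unfolding J_def using q k C by (intro tendsto_mult tendsto_const weighted_log_bound_tendsto)
  then have ev2: "\<forall>\<^sub>F \<alpha> in at_top. 8 powr q * (\<alpha>\<^sup>2 * J \<alpha>) < exp (- 12) * (9 / 16) powr (p + 1) * (pi / 4)"
    by (rule order_tendstoD) simp
  \<comment> \<open>Ensures R <= 1/2 eventually, which keeps the bump near the boundary in the
    region where the weight is bounded below.\<close>
  have "((\<lambda>\<alpha>. C * \<alpha> powr (- \<delta>)) \<longlongrightarrow> C * 0) at_top"
    using assms(2) by (intro tendsto_mult tendsto_const tendsto_neg_powr filterlim_ident) auto
  then have ev3: "\<forall>\<^sub>F \<alpha> in at_top. C * \<alpha> powr (- \<delta>) < 1 / 2"
    by (rule order_tendstoD) simp
  have "\<forall>\<^sub>F \<alpha> in at_top. S_alpha (R \<alpha>) \<alpha> p < S_alpha_rad (R \<alpha>) \<alpha> p"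
    using assms(3) ev1 ev2 ev3 eventually_ge_at_top[of 12]
  proof eventually_elim
    case (elim \<alpha>)
    have "R \<alpha> = (\<alpha> powr \<delta> * R \<alpha>) * \<alpha> powr (- \<delta>)" using elim by (simp add: powr_minus)
    also have "\<dots> \<le> C * \<alpha> powr (- \<delta>)" using elim C by (intro mult_right_mono) auto
    finally have RC: "R \<alpha> \<le> C * \<alpha> powr (- \<delta>)" .
    show ?case
    proof (rule S_alpha_less_rad[OF _ _ assms(1) _ q_def, where J = "J \<alpha>"])
      show "J \<alpha> > 0" unfolding J_def using q k \<eta> C elim
        by (intro add_pos_nonneg mult_pos_pos mult_nonneg_nonneg) auto
      have "(\<integral>\<^sup>+x. indicator unit_ball x * ennreal (V_weight (R \<alpha>) \<alpha> (norm x) * ln (1 / norm x) powr q) \<partial>lborel) \<le>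
        ennreal ((2 * q / \<alpha>) powr q * (4 * pi / \<alpha>)
          + k powr k * (q / \<eta>) powr q * (R \<alpha> / \<alpha>) powr k * (2 * pi / (2 - k - \<eta>)))"
        using elim q k \<eta> by (intro nn_integral_weighted_log_le) auto
      also have "\<dots> \<le> ennreal (J \<alpha>)"
        unfolding J_def using RC elim k \<eta>
        by (intro ennreal_leI add_left_mono mult_right_mono mult_left_mono powr_mono2 divide_right_mono) auto
      finally show "(\<integral>\<^sup>+x. indicator unit_ball x * ennreal (V_weight (R \<alpha>) \<alpha> (norm x) * ln (1 / norm x) powr q) \<partial>lborel)
        \<le> ennreal (J \<alpha>)" .
    qed (use elim RC in auto)
  qed
  then obtain a1 where a1: "\<And>\<alpha>. \<alpha> \<ge> a1 \<Longrightarrow> S_alpha (R \<alpha>) \<alpha> p < S_alpha_rad (R \<alpha>) \<alpha> p"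
    unfolding eventually_at_top_linorder by blast
  show ?thesis
  proof (intro exI[of _ "max 1 a1"] conjI allI impI)
    fix \<alpha> w assume "max 1 a1 < \<alpha>"
    then show S: "S_alpha (R \<alpha>) \<alpha> p < S_alpha_rad (R \<alpha>) \<alpha> p" by (intro a1) simp
    show "\<not> radial w" if "groundstate (R \<alpha>) \<alpha> p w"
      using S that by (rule groundstate_not_radial)
  qed simp
qed

end
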